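(* Let $FA=GF_2\langle a_1,\dots,a_k\rangle$ and $n\ge 2$. Let $u_1,\dots,u_n,v_1,\dots,v_n\in FA$ and suppose that the top homogeneous parts of all the $u_i$ and $v_i$ are monomials with no periodicity, and that $u_i\ne v_i$ for at least one index $i$, $1\le i\le n$. Suppose that the equation $$u_1xu_2xu_3\cdots u_{n-1}xu_n \,=\, v_1xv_2xv_3\cdots v_{n-1}xv_n$$ has a solution $x_1\in FA$ of degree bigger than $2(\deg(u_1)+\cdots+\deg(u_n))^2$. Suppose further that all the periodicity in the top monomials of the two sides of the equation, after substituting the solution $x_1$, is contained in the periodicity of the top monomial of the solution $x_1$. Then there exist elements $s,t\in FA$, $\deg(s)=\deg(t)\le \max_i \deg(u_i)$, such that: (1) every solution of the equation $sx=xt$ is a solution of the given equation; (2) every solution $x_2$ of the given equation that satisfies $$\deg(x_2)>2(2+2^{\deg(s)+2})+\bigl(2(\deg(u_1)+\cdots+\deg(u_n))\bigr)^2$$ is a solution of the equation $sx=xt$.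
   Context: $FA$ is the free associative (unital) algebra over the field with two elements. A monomial is a word in $a_1,\dots,a_k$; $\deg$ is the maximal length of a monomial appearing in an element. A monomial has no periodicity if it contains no (contiguous) subword of the form $\alpha^2$ for a non-trivial word $\alpha$. Periodicity hypothesis on $x_1$: the top degree homogeneous part of $x_1$ is a monomial $x_1^0$; let $u_i^0,v_i^0$ be the top monomials of $u_i,v_i$, and consider the two words $W_u=u_1^0x_1^0u_2^0x_1^0\cdots u_{n-1}^0x_1^0u_n^0$ and $W_v=v_1^0x_1^0v_2^0x_1^0\cdots v_{n-1}^0x_1^0v_n^0$, each with its $n-1$ displayed appearances of $x_1^0$. Let $p$ be the smallest period of the word $x_1^0$. For each displayed appearance of $x_1^0$ in $W\in\{W_u,W_v\}$, its run is the maximal subword occurrence of $W$ that contains this appearance and has period $p$. All the periodicity in $W$ is contained in the periodicity of the top monomial of $x_1$ if distinct displayed appearances of $x_1^0$ in $W$ have distinct runs, and every occurrence in $W$ of a subword $\alpha^2$, with $\alpha$ a non-trivial word, is contained in the run of one of the displayed appearances. This is required for both $W_u$ and $W_v$. *)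

theory Defs
  imports "HOL-Library.Poly_Mapping" "HOL-Library.Z2" "HOL-Library.Sublist"
begin

section \<open>The free associative algebra over the field with two elements\<close>

text \<open>
  Words over \<open>'a\<close> form the free monoid under concatenation.  The convolution product of
  \<^theory>\<open>HOL-Library.Poly_Mapping\<close> is indexed by an additively written (not necessarily
  commutative) monoid, so concatenation appears there as \<open>+\<close> and the empty word as \<open>0\<close>.
\<close>

instantiation list :: (type) monoid_add
begin

definition zero_list :: "'a list" where "zero_list = []"

definition plus_list :: "'a list \<Rightarrow> 'a list \<Rightarrow> 'a list" where "plus_list xs ys = xs @ ys"

instance by standard (simp_all add: zero_list_def plus_list_def)

end

text \<open>
  The monoid algebra of the free monoid over \<^typ>\<open>bit\<close>, the field with two elements.
  The free generators \<open>a\<^sub>1, \<dots>, a\<^sub>k\<close> are the elements of a finite type \<open>'a\<close> with \<open>CARD('a) = k\<close>.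
\<close>

type_synonym 'a free_alg = "'a list \<Rightarrow>\<^sub>0 bit"

text \<open>
  The value at \<open>0\<close> is a dummy; wherever the degree of an element matters, the element is
  known to be nonzero or is compared by a strict lower bound on its degree.
\<close>

definition deg :: "'a free_alg \<Rightarrow> nat" where
  "deg x = (if x = 0 then 0 else Max (length ` Poly_Mapping.keys x))"

definition top_part :: "'a free_alg \<Rightarrow> 'a free_alg" where
  "top_part x = (\<Sum>w | w \<in> Poly_Mapping.keys x \<and> length w = deg x. Poly_Mapping.single w (Poly_Mapping.lookup x w))"

definition is_monomial :: "'a free_alg \<Rightarrow> bool" where
  "is_monomial x \<longleftrightarrow> (\<exists>w. x = Poly_Mapping.single w 1)"

definition top_word :: "'a free_alg \<Rightarrow> 'a list" where
  "top_word x = (THE w. top_part x = Poly_Mapping.single w 1)"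

lemma top_word_eqI:
  assumes "top_part x = Poly_Mapping.single w 1"
  shows "top_word x = w"
  unfolding top_word_def
proof (rule the_equality[where P = "\<lambda>w. top_part x = Poly_Mapping.single w 1", OF assms])
  fix w' assume "top_part x = Poly_Mapping.single w' 1"
  with assms have "Poly_Mapping.keys (Poly_Mapping.single w' (1::bit)) = Poly_Mapping.keys (Poly_Mapping.single w (1::bit))"
    by simp
  then show "w' = w" by simp
qed

text \<open>\<open>side u x n\<close> is \<open>u\<^sub>1 x u\<^sub>2 x \<dots> u\<^bsub>n-1\<^esub> x u\<^sub>n\<close>.\<close>

definition side :: "(nat \<Rightarrow> 'a free_alg) \<Rightarrow> 'a free_alg \<Rightarrow> nat \<Rightarrow> 'a free_alg" where
  "side u x n = u 1 * prod_list (map (\<lambda>i. x * u i) [2..<Suc n])"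

section \<open>Periodicity of words\<close>

definition no_periodicity :: "'a list \<Rightarrow> bool" where
  "no_periodicity w \<longleftrightarrow> \<not> (\<exists>\<alpha>. \<alpha> \<noteq> [] \<and> sublist (\<alpha> @ \<alpha>) w)"

definition has_period :: "nat \<Rightarrow> 'a list \<Rightarrow> bool" where
  "has_period p w \<longleftrightarrow> 0 < p \<and> (\<forall>i. i + p < length w \<longrightarrow> w ! i = w ! (i + p))"

definition min_period :: "'a list \<Rightarrow> nat" where
  "min_period w = (LEAST p. has_period p w)"

text \<open>
  An occurrence of a subword in \<open>W\<close> is a pair \<open>(i, j)\<close> with \<open>i \<le> j \<le> length W\<close>, standing for
  the letters of \<open>W\<close> at the (zero-based) positions \<open>i, \<dots>, j - 1\<close>.
\<close>

type_synonym occ = "nat \<times> nat"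

definition is_occ :: "'a list \<Rightarrow> occ \<Rightarrow> bool" where
  "is_occ W o1 \<longleftrightarrow> fst o1 \<le> snd o1 \<and> snd o1 \<le> length W"

definition subword_at :: "'a list \<Rightarrow> occ \<Rightarrow> 'a list" where
  "subword_at W o1 = drop (fst o1) (take (snd o1) W)"

definition occ_within :: "occ \<Rightarrow> occ \<Rightarrow> bool" where
  "occ_within o1 o2 \<longleftrightarrow> fst o2 \<le> fst o1 \<and> snd o1 \<le> snd o2"

definition is_run :: "'a list \<Rightarrow> nat \<Rightarrow> occ \<Rightarrow> occ \<Rightarrow> bool" where
  "is_run W p o1 r \<longleftrightarrow>
     is_occ W r \<and> occ_within o1 r \<and> has_period p (subword_at W r) \<and>
     (\<forall>r'. is_occ W r' \<and> occ_within r r' \<and> has_period p (subword_at W r') \<longrightarrow> r' = r)"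

definition run :: "'a list \<Rightarrow> nat \<Rightarrow> occ \<Rightarrow> occ" where
  "run W p o1 = (THE r. is_run W p o1 r)"

text \<open>\<open>side_word w z n\<close> is \<open>w\<^sub>1 z w\<^sub>2 z \<dots> w\<^bsub>n-1\<^esub> z w\<^sub>n\<close>.\<close>

definition side_word :: "(nat \<Rightarrow> 'a list) \<Rightarrow> 'a list \<Rightarrow> nat \<Rightarrow> 'a list" where
  "side_word w z n = w 1 @ concat (map (\<lambda>i. z @ w i) [2..<Suc n])"

text \<open>
  The \<open>j\<close>-th displayed appearance of \<open>z\<close> in \<open>side_word w z n\<close>, for \<open>1 \<le> j < n\<close>, comes
  right after the prefix \<open>w\<^sub>1 z w\<^sub>2 z \<dots> z w\<^sub>j\<close>.
\<close>

definition displayed :: "(nat \<Rightarrow> 'a list) \<Rightarrow> 'a list \<Rightarrow> nat \<Rightarrow> occ" where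
  "displayed w z j = (let b = length (side_word w z j) in (b, b + length z))"

definition periodicity_contained :: "(nat \<Rightarrow> 'a list) \<Rightarrow> 'a list \<Rightarrow> nat \<Rightarrow> bool" where
  "periodicity_contained w z n \<longleftrightarrow>
     (let W = side_word w z n; R = (\<lambda>j. run W (min_period z) (displayed w z j)) in
       inj_on R {1..<n} \<and>
       (\<forall>o1 \<alpha>. is_occ W o1 \<and> \<alpha> \<noteq> [] \<and> subword_at W o1 = \<alpha> @ \<alpha> \<longrightarrow>
          (\<exists>j\<in>{1..<n}. occ_within o1 (R j))))"

subsection \<open>Runs are well defined\<close>

lemma has_period_subword_at:
  assumes "is_occ W (a, b)"
  shows "has_period p (subword_at W (a, b)) \<longleftrightarrow>
    0 < p \<and> (\<forall>i. a \<le> i \<and> i + p < b \<longrightarrow> W ! i = W ! (i + p))"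
proof -
  have "(\<forall>i. i + p < b - a \<longrightarrow> W ! (a + i) = W ! (a + i + p)) \<longleftrightarrow>
        (\<forall>i. a \<le> i \<and> i + p < b \<longrightarrow> W ! i = W ! (i + p))" (is "?L \<longleftrightarrow> ?R")
  proof
    assume L: ?L
    show ?R
    proof (intro allI impI)
      fix i assume "a \<le> i \<and> i + p < b"
      then have "i - a + p < b - a" "a + (i - a) = i" by linarith+
      then show "W ! i = W ! (i + p)" using L[rule_format, of "i - a"] by metis
    qed
  next
    assume ?R then show ?L by simp
  qed
  moreover have "has_period p (subword_at W (a, b)) \<longleftrightarrow>
      0 < p \<and> (\<forall>i. i + p < b - a \<longrightarrow> W ! (a + i) = W ! (a + i + p))"
    using assms by (auto simp: has_period_def subword_at_def is_occ_def add.assoc)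
  ultimately show ?thesis by simp
qed

lemma is_run_unique:
  assumes "p \<le> j - i" and r1: "is_run W p (i, j) r1" and r2: "is_run W p (i, j) r2"
  shows "r1 = r2"
proof -
  obtain a b c d where r: "r1 = (a, b)" "r2 = (c, d)" by (metis prod.exhaust)
  have o: "is_occ W (a, b)" "is_occ W (c, d)" and le: "a \<le> i" "c \<le> i" "j \<le> b" "j \<le> d"
    and pp: "has_period p (subword_at W (a, b))" "has_period p (subword_at W (c, d))"
    using r1 r2 by (auto simp: r is_run_def occ_within_def)
  let ?r = "(min a c, max b d)"
  have oc: "is_occ W ?r" using o by (auto simp: is_occ_def)
  have "W ! k = W ! (k + p)" if k: "min a c \<le> k" "k + p < max b d" for k
  proof -
    have P1: "a \<le> k \<Longrightarrow> k + p < b \<Longrightarrow> W ! k = W ! (k + p)"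
      and P2: "c \<le> k \<Longrightarrow> k + p < d \<Longrightarrow> W ! k = W ! (k + p)"
      using pp o by (auto simp: has_period_subword_at)
    have "i + p \<le> j" using assms(1) pp(1) o by (auto simp: has_period_subword_at)
    then have "a \<le> k \<and> k + p < b \<or> c \<le> k \<and> k + p < d"
      using k le by linarith
    then show ?thesis using P1 P2 by blast
  qed
  then have "has_period p (subword_at W ?r)"
    using pp o oc by (auto simp: has_period_subword_at)
  moreover have "occ_within r1 ?r" "occ_within r2 ?r" by (auto simp: r occ_within_def)
  ultimately have "?r = r1" "?r = r2" using r1 r2 oc unfolding is_run_def by blast+
  then show ?thesis by simp
qed

lemma is_run_ex:
  assumes "is_occ W o1" and "has_period p (subword_at W o1)"
  shows "\<exists>r. is_run W p o1 r"
proof -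
  let ?P = "\<lambda>r. is_occ W r \<and> occ_within o1 r \<and> has_period p (subword_at W r)"
  let ?len = "\<lambda>r::occ. snd r - fst r"
  have P: "?P o1" using assms by (simp add: occ_within_def)
  have "\<forall>r. ?P r \<longrightarrow> ?len r < Suc (length W)" by (auto simp: is_occ_def)
  from ex_has_greatest_nat[of ?P, OF P this]
  obtain r where r: "?P r" and mx: "\<And>r'. ?P r' \<Longrightarrow> ?len r' \<le> ?len r" by blast
  have "r' = r" if "is_occ W r'" "occ_within r r'" "has_period p (subword_at W r')" for r'
  proof -
    have "?len r' \<le> ?len r" using r that by (intro mx) (auto simp: occ_within_def)
    then show ?thesis using that r by (auto simp: occ_within_def is_occ_def prod_eq_iff)
  qed
  then have "is_run W p o1 r" using r unfolding is_run_def by blast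
  then show ?thesis by blast
qed

lemma is_run_run:
  assumes "is_occ W o1" and "has_period p (subword_at W o1)" and "p \<le> length (subword_at W o1)"
  shows "is_run W p o1 (run W p o1)"
proof -
  obtain i j where ij: "o1 = (i, j)" by (cases o1)
  obtain r where r: "is_run W p o1 r" using is_run_ex assms by blast
  have "p \<le> j - i" using assms by (auto simp: ij subword_at_def is_occ_def)
  then show ?thesis
    unfolding run_def using theI[of "is_run W p o1" r] r is_run_unique[of p j i W] ij by blast
qed

lemma min_period:
  assumes "z \<noteq> []"
  shows "has_period (min_period z) z" "min_period z \<le> length z"
proof -
  have "has_period (length z) z" using assms by (simp add: has_period_def)
  then show "has_period (min_period z) z" "min_period z \<le> length z"
    unfolding min_period_def by (rule LeastI, rule Least_le)
qed

lemma side_word_Suc: "1 \<le> n \<Longrightarrow> side_word w z (Suc n) = side_word w z n @ z @ w (Suc n)"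
  by (simp add: side_word_def)

lemma displayed_correct:
  assumes "1 \<le> j" "j < n"
  shows "is_occ (side_word w z n) (displayed w z j)"
    and "subword_at (side_word w z n) (displayed w z j) = z"
proof -
  have "\<exists>ys. side_word w z n = side_word w z j @ z @ ys"
    using Suc_leI[OF assms(2)] assms(1)
  proof (induction n rule: dec_induct)
    case base
    then show ?case by (auto simp: side_word_Suc)
  next
    case (step m)
    then show ?case by (auto simp: side_word_Suc)
  qed
  then show "is_occ (side_word w z n) (displayed w z j)"
    and "subword_at (side_word w z n) (displayed w z j) = z"
    by (auto simp: is_occ_def subword_at_def displayed_def Let_def)
qed

end

theory Submission
  imports Defs
begin

text \<open>
  Write \<open>z\<close> for the top word of \<open>x\<^sub>1\<close>, \<open>p\<close> for its least period, and \<open>\<rho>\<close>, \<open>w\<close> for the prefix and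
  the suffix of \<open>z\<close> of length \<open>p\<close>, so that \<open>\<rho> z = z w\<close>.  Throughout, an equation in the free
  algebra is compared with the equation that it induces between the words of maximal length.

  Let \<open>i\<close> be the first index with \<open>u\<^sub>i \<noteq> v\<^sub>i\<close>.  After cancelling on the left the equation reads
  \<open>u\<^sub>i x Y\<^sub>u = v\<^sub>i x Y\<^sub>v\<close>.  If the degrees of \<open>u\<^sub>i\<close> and \<open>v\<^sub>i\<close> differ, call the shorter one \<open>r\<close> and the
  longer one \<open>B\<close>; if they agree, put \<open>r = u\<^sub>i + v\<^sub>i\<close>, which has lower degree, and \<open>B = v\<^sub>i\<close>.  In both
  cases \<open>r x Y = B x Y'\<close> with \<open>deg r < deg B\<close>.  Dividing \<open>B\<close> by \<open>r\<close> with remainder in the free algebra, a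
  nonzero remainder would force the top word of \<open>B\<close> to end in \<open>e \<rho>\<close> with \<open>e\<close> a nonempty prefix of
  \<open>z\<close>; such a word contains a square, which is excluded.  Hence \<open>B = r s\<close> exactly, and \<open>s\<close> has top
  word \<open>\<rho>\<close> (\<open>left_factor_of_longer\<close>, \<open>splitting_exists\<close>).  What remains after cancelling \<open>r\<close> has the form
  \<open>s x Y' = x Y\<close>.  Dividing \<open>s x\<close> by \<open>x\<close>, a nonzero remainder would force the top words of \<open>Y\<close> to
  begin with \<open>w e\<close> for a nonempty suffix \<open>e\<close> of \<open>w\<close>, again a forbidden square.  Hence \<open>s x = x t\<close> for some \<open>t\<close>
  with top word \<open>w\<close> (\<open>right_conjugate_exists\<close>).  Now \<open>s\<close> can be moved across \<open>x\<close>, where it becomes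
  \<open>t\<close> and is absorbed into the next pair of coefficients, and the argument repeats.  Later
  conjugators differ from \<open>s\<close> by a constant only, since a difference of positive degree would
  give \<open>z\<close> a period below \<open>p\<close> (\<open>conjugators_differ_by_constant\<close>).  So the same \<open>s\<close> and
  \<open>t\<close> explain the whole equation, which gives (1) (\<open>intertwined_solution\<close>).

  The two exclusions of squares concern words \<open>z U z\<close> that straddle a coefficient, and not only
  the square-free word \<open>U\<close>.  They rest on the periodicity hypothesis in the form of
  \<open>junction\<close>: every square in \<open>z U z\<close> lies in a piece of period \<open>p\<close> that reaches one of the two
  ends, although \<open>z U z\<close> itself does not have period \<open>p\<close>.  The point is that the two periodic
  pieces cannot meet in positions that follow the pattern of \<open>z\<close>: otherwise
  \<open>(\<rho> h)(\<rho> h)\<close> with \<open>h\<close> a proper prefix of \<open>\<rho>\<close> would be a square that overlaps both pieces in at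
  least \<open>p\<close> letters, and they would merge (\<open>junction_no_overlap\<close>).

  For (2), nothing is assumed about the top part of \<open>x\<^sub>2\<close>.  But \<open>s x\<^sub>2 Y' = x\<^sub>2 Y\<close>, where the top words
  of \<open>Y\<close> begin with \<open>w\<close>, forces every top word of \<open>x\<^sub>2\<close> to be a prefix of \<open>\<rho> \<rho> \<rho> \<dots>\<close>; so there is
  only one (\<open>long_solution_top\<close>), and the local arguments apply to it as well.  They give
  \<open>s x\<^sub>2 = x\<^sub>2 t'\<close>, and a nonzero \<open>t + t'\<close> is refuted by comparing, one coefficient later, the
  factorizations obtained for \<open>x\<^sub>1\<close> with the equation for \<open>x\<^sub>2\<close> (\<open>no_constant_shift\<close>, \<open>long_solution\<close>).
\<close>

section \<open>Periods of words\<close>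

lemma has_period_nth: "has_period p w \<Longrightarrow> i + p < length w \<Longrightarrow> w ! i = w ! (i + p)"
  by (simp add: has_period_def)

lemma has_period_pos: "has_period p w \<Longrightarrow> 0 < p"
  by (simp add: has_period_def)

lemma has_period_nth_mult:
  assumes "has_period p w" "i + k * p < length w"
  shows "w ! i = w ! (i + k * p)"
  using assms(2)
proof (induction k)
  case (Suc k)
  then have "w ! i = w ! (i + k * p)" by simp
  also have "\<dots> = w ! (i + k * p + p)"
    using has_period_nth[OF assms(1), of "i + k * p"] Suc.prems by (simp add: add.assoc add.commute)
  finally show ?case by (simp add: algebra_simps)
qed simp

lemma has_period_nth_mod:
  assumes "has_period p w" "i < length w"
  shows "w ! i = w ! (i mod p)"
  using has_period_nth_mult[OF assms(1), of "i mod p" "i div p"] assms(2) by simp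

lemma has_period_infix:
  assumes "has_period p (A @ B @ C)"
  shows "has_period p B"
  unfolding has_period_def
proof (intro conjI allI impI)
  show "0 < p" using assms by (rule has_period_pos)
  fix i assume "i + p < length B"
  then show "B ! i = B ! (i + p)"
    using has_period_nth[OF assms, of "length A + i"] by (simp add: nth_append add.assoc)
qed

lemma has_period_prefix: "has_period p (A @ B) \<Longrightarrow> has_period p A"
  using has_period_infix[of p "[]" A B] by simp

lemma has_period_suffix: "has_period p (A @ B) \<Longrightarrow> has_period p B"
  using has_period_infix[of p A B "[]"] by simp

text \<open>
  Two stretches of the same period combine as soon as they share a full period, because every
  pair of positions at distance \<open>p\<close> then lies in one of them.
\<close>

lemma has_period_glue:
  assumes AB: "has_period p (A @ B)" and BC: "has_period p (B @ C)" and len: "p \<le> length B"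
  shows "has_period p (A @ B @ C)"
  unfolding has_period_def
proof (intro conjI allI impI)
  show "0 < p" using AB by (rule has_period_pos)
  fix i assume i: "i + p < length (A @ B @ C)"
  show "(A @ B @ C) ! i = (A @ B @ C) ! (i + p)"
  proof (cases "i < length A")
    case True
    then have ip: "i + p < length (A @ B)" using len by simp
    then have "(A @ B) ! i = (A @ B) ! (i + p)" by (rule has_period_nth[OF AB])
    moreover have "((A @ B) @ C) ! j = (A @ B) ! j" if "j < length (A @ B)" for j
      using that by (simp only: nth_append if_True)
    ultimately show ?thesis using ip by simp
  next
    case False
    then have "(B @ C) ! (i - length A) = (B @ C) ! (i - length A + p)"
      using i by (intro has_period_nth[OF BC]) simp
    then show ?thesis using False by (simp add: nth_append_right)
  qed
qed

lemma has_period_rev: "has_period p w \<Longrightarrow> has_period p (rev w)"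
  unfolding has_period_def
proof (intro conjI allI impI; elim conjE)
  fix i assume p: "0 < p" and w: "\<forall>i. i + p < length w \<longrightarrow> w ! i = w ! (i + p)"
    and i: "i + p < length (rev w)"
  have "w ! (length w - Suc (i + p)) = w ! (length w - Suc (i + p) + p)"
    using w i p by (intro w[rule_format]) auto
  moreover have "length w - Suc (i + p) + p = length w - Suc i" using i by simp
  ultimately show "rev w ! i = rev w ! (i + p)" using i by (simp add: rev_nth)
qed

lemma has_period_conjugate:
  assumes "0 < length a" "a @ w = w @ b"
  shows "has_period (length a) w"
  unfolding has_period_def
proof (intro conjI allI impI)
  show "0 < length a" by fact
  fix i assume "i + length a < length w"
  then show "w ! i = w ! (i + length a)"
    using arg_cong[OF assms(2), of "\<lambda>l. l ! (i + length a)"] by (simp add: nth_append)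
qed

lemma has_period_drop_take:
  assumes "has_period p w" "p \<le> length w"
  shows "take p w @ w = w @ drop (length w - p) w"
proof (rule nth_equalityI)
  show "length (take p w @ w) = length (w @ drop (length w - p) w)" using assms by simp
  fix i assume "i < length (take p w @ w)"
  then have i: "i < p + length w" using assms by simp
  show "(take p w @ w) ! i = (w @ drop (length w - p) w) ! i"
  proof (cases "i < length w")
    case True
    then show ?thesis using assms has_period_nth[OF assms(1), of "i - p"]
      by (auto simp: nth_append)
  next
    case False
    then show ?thesis using i assms by (simp add: nth_append)
  qed
qed

text \<open>
  The step of the Euclidean algorithm in the theorem of Fine and Wilf: from any position one
  can either go up by \<open>b\<close> and down by \<open>a\<close> or first down by \<open>a\<close> and then up by \<open>b\<close>.
\<close>

lemma has_period_diff:
  assumes a: "has_period a w" and b: "has_period b w" and "a < b" "a + b \<le> length w"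
  shows "has_period (b - a) w"
  unfolding has_period_def
proof (intro conjI allI impI)
  show "0 < b - a" using assms by simp
  fix i assume i: "i + (b - a) < length w"
  show "w ! i = w ! (i + (b - a))"
  proof (cases "i + b < length w")
    case True
    then show ?thesis
      using has_period_nth[OF b, of i] has_period_nth[OF a, of "i + (b - a)"] assms by simp
  next
    case False
    then have "a \<le> i" using assms by simp
    then show ?thesis
      using has_period_nth[OF b, of "i - a"] has_period_nth[OF a, of "i - a"] i assms by simp
  qed
qed

text \<open>
  The least period divides every period that is short enough, by repeated subtraction.  It is
  used to see that shifts of \<open>z\<close> against itself are multiples of \<open>p\<close>.
\<close>

lemma minimal_period_dvd:
  assumes "has_period p w" and "\<And>d. d < p \<Longrightarrow> \<not> has_period d w"
    and "has_period k w" "k + p \<le> length w"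
  shows "p dvd k"
  using assms(3,4)
proof (induction k rule: less_induct)
  case (less k)
  consider "k < p" | "k = p" | "p < k" by linarith
  then show ?case
  proof cases
    case 3
    then have "has_period (k - p) w"
      using has_period_diff[OF assms(1) less.prems(1)] less.prems by simp
    then have "p dvd k - p"
      using less.IH[of "k - p"] less.prems 3 has_period_pos[OF assms(1)] by simp
    then show ?thesis using 3 by (simp add: dvd_minus_self)
  qed (use assms(2) less.prems in auto)
qed

section \<open>Squares between two runs\<close>

lemma no_periodicityD: "no_periodicity w \<Longrightarrow> w = A @ s @ s @ B \<Longrightarrow> s = []"
  unfolding no_periodicity_def sublist_def by (metis append_assoc)

lemma no_periodicity_rev: "no_periodicity w \<Longrightarrow> no_periodicity (rev w)"
  unfolding no_periodicity_def
  by (metis rev_append rev_is_Nil_conv rev_rev_ident sublist_rev)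

text \<open>
  The local form of the periodicity hypothesis around one coefficient \<open>U\<close>: the runs of the
  neighbouring appearances of \<open>z\<close> differ, and each square lies in one run of period \<open>p\<close>.  A run
  that contains the square and an appearance of \<open>z\<close> further left or right is here cut down to
  \<open>z U z\<close>, where it becomes a prefix or a suffix.  The notion is invariant under reversal, which halves
  the work below.
\<close>

definition junction :: "nat \<Rightarrow> 'a list \<Rightarrow> 'a list \<Rightarrow> bool" where
  "junction p z U \<longleftrightarrow> \<not> has_period p (z @ U @ z) \<and>
    (\<forall>A s B. z @ U @ z = A @ s @ s @ B \<and> s \<noteq> [] \<longrightarrow>
       has_period p (A @ s @ s) \<or> has_period p (s @ s @ B))"

lemma junction_rev:
  assumes "junction p z U"
  shows "junction p (rev z) (rev U)"
  unfolding junction_def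
proof (intro conjI allI impI; (elim conjE)?)
  show "\<not> has_period p (rev z @ rev U @ rev z)"
    using assms has_period_rev[of p "rev z @ rev U @ rev z"] by (auto simp: junction_def)
  fix A s B assume eq: "rev z @ rev U @ rev z = A @ s @ s @ B" and s: "s \<noteq> []"
  have "z @ U @ z = rev (rev z @ rev U @ rev z)" by simp
  also have "\<dots> = rev B @ rev s @ rev s @ rev A" unfolding eq by simp
  finally have "has_period p (rev B @ rev s @ rev s) \<or> has_period p (rev s @ rev s @ rev A)"
    using assms s unfolding junction_def by simp
  then show "has_period p (A @ s @ s) \<or> has_period p (s @ s @ B)"
    using has_period_rev[of p "rev B @ rev s @ rev s"] has_period_rev[of p "rev s @ rev s @ rev A"]
    by auto
qed

text \<open>
  The two periodic pieces at a junction cannot touch.  Suppose that the left piece covers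
  \<open>z g\<close> and that the right piece starts where it ends, with \<open>k z\<close> beginning like \<open>z\<close>.  Cut \<open>z g\<close> as
  \<open>A \<rho> h\<close> at the last full period; then \<open>\<rho> h\<close> is also a prefix of \<open>k z\<close>, so \<open>(\<rho> h)(\<rho> h)\<close> is a square.
  The piece of period \<open>p\<close> around it shares at least \<open>p\<close> letters with both sides and glues them
  together.  The word \<open>k\<close> is empty or \<open>\<rho>\<close> in applications.
\<close>

lemma junction_no_overlap:
  assumes J: "junction p z (g @ k)" and z: "has_period p z" "2 * p \<le> length z"
    and zg: "has_period p (z @ g)" and kz: "has_period p (k @ z)"
    and k: "take (2 * p) (k @ z) = take (2 * p) z"
  shows False
proof -
  \<comment> \<open>The word \<open>s\<close> is \<open>\<rho> h\<close>: the last full period of \<open>z g\<close> and what follows it.\<close>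
  let ?h = "length (z @ g) mod p" and ?q = "length (z @ g) div p"
  let ?i = "length (z @ g) - p - ?h"
  define A where "A = take ?i (z @ g)"
  define s where "s = drop ?i (z @ g)"
  have p: "0 < p" using z has_period_pos by blast
  have h: "?h < p" using p by simp
  have i: "?i = (?q - 1) * p" "?i + (p + ?h) = length (z @ g)"
  proof -
    have eq: "length (z @ g) = ?q * p + ?h" by simp
    have "1 \<le> ?q" using z p by (simp add: div_greater_zero_iff Suc_le_eq)
    then have "p \<le> ?q * p" by simp
    then show "?i = (?q - 1) * p" "?i + (p + ?h) = length (z @ g)"
      using eq unfolding diff_mult_distrib by linarith+
  qed
  have ls: "length s = p + ?h" unfolding s_def length_drop using i(2) by linarith
  have zg_eq: "z @ g = A @ s" unfolding A_def s_def by (rule append_take_drop_id[symmetric])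
  \<comment> \<open>\<open>s\<close> begins at a multiple of \<open>p\<close>, so it is a prefix of \<open>z\<close> continued with period \<open>p\<close>.\<close>
  have "s = take (p + ?h) z"
  proof (rule nth_equalityI)
    show "length s = length (take (p + ?h) z)" using ls h z by simp
    fix j assume "j < length s"
    then have j: "j < p + ?h" using ls by simp
    have "s ! j = (z @ g) ! (j + (?q - 1) * p)"
      unfolding s_def i(1)[symmetric] using i(2) by (subst nth_drop) (simp_all add: add.commute del: length_append)
    also have "\<dots> = (z @ g) ! j"
      using has_period_nth_mult[OF zg, of j "?q - 1"] i j by (simp del: length_append)
    finally show "s ! j = take (p + ?h) z ! j" using j h z by (simp add: nth_append)
  qed
  also have "\<dots> = take (p + ?h) (take (2 * p) z)" using h by (simp add: min_def)
  also have "\<dots> = take (p + ?h) (k @ z)" unfolding k[symmetric] using h by (simp add: min_def)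
  finally have "k @ z = s @ drop (p + ?h) (k @ z)" by (simp only: append_take_drop_id)
  then obtain B where B: "k @ z = s @ B" by blast
  have "z @ (g @ k) @ z = (z @ g) @ (k @ z)" by simp
  then have whole: "z @ (g @ k) @ z = A @ s @ s @ B" unfolding zg_eq B by simp
  have "s \<noteq> []" using ls p by auto
  then consider "has_period p (A @ s @ s)" | "has_period p (s @ s @ B)"
    using J unfolding junction_def whole by blast
  then have "has_period p (A @ s @ s @ B)"
  proof cases
    case 1
    moreover have "has_period p (s @ B)" using kz unfolding B .
    ultimately have "has_period p ((A @ s) @ s @ B)" by (intro has_period_glue) (simp_all add: ls)
    then show ?thesis by simp
  next
    case 2
    moreover have "has_period p (A @ s)" using zg unfolding zg_eq .
    ultimately show ?thesis using has_period_glue[of p A s "s @ B"] by (simp add: ls)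
  qed
  then show False using J unfolding junction_def whole by blast
qed

lemma junction_not_periodic_left:
  assumes "junction p z U" "has_period p z" "2 * p \<le> length z"
  shows "\<not> has_period p (z @ U)"
proof
  assume "has_period p (z @ U)"
  then show False
    by (rule junction_no_overlap[of p z U "[]", rotated 3]) (use assms in simp_all)
qed

lemma junction_no_overlap_rev:
  assumes J: "junction p z (k @ g)" and z: "has_period p z" "2 * p \<le> length z"
    and k: "k = drop (length z - p) z" and gz: "has_period p (g @ z)"
  shows False
proof (rule junction_no_overlap[of p "rev z" "rev g" "rev k"])
  have pl: "p \<le> length z" using z by simp
  show "junction p (rev z) (rev g @ rev k)" using junction_rev[OF J] by simp
  show "has_period p (rev z)" "2 * p \<le> length (rev z)" using z has_period_rev by auto
  show "has_period p (rev z @ rev g)" using has_period_rev[OF gz] by simp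
  have zk: "take p z @ z = z @ k" unfolding k using has_period_drop_take[OF z(1) pl] .
  have "has_period (length (take p z)) (take p z @ z)"
  proof (rule has_period_conjugate)
    show "0 < length (take p z)" using z has_period_pos[OF z(1)] by auto
    show "take p z @ take p z @ z = (take p z @ z) @ k" using zk by simp
  qed
  then have "has_period p (z @ k)" using zk pl by (simp add: min_absorb2)
  then show "has_period p (rev k @ rev z)" using has_period_rev by (metis rev_append)
  have "rev k @ rev z = rev z @ rev (take p z)" using zk by (metis rev_append)
  then show "take (2 * p) (rev k @ rev z) = take (2 * p) (rev z)" using z by simp
qed

text \<open>
  If \<open>w e\<close>, with \<open>e\<close> a suffix of \<open>w\<close>, were a prefix of \<open>U z\<close>, the square \<open>e e\<close> would straddle the point
  up to which the left run is known to extend.  It is not inside \<open>U\<close>, so it lies in a run of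
  period \<open>p\<close>, which then either extends the left piece over all of \<open>U\<close> or the right
  piece back to a full period of the left one; both are excluded by \<open>junction_no_overlap\<close>.
\<close>

lemma junction_right:
  assumes J: "junction p z U" and U: "no_periodicity U" and z: "has_period p z" "2 * p \<le> length z"
    and w: "w = drop (length z - p) z"
    and e: "e \<noteq> []" "length e \<le> p" "suffix e w"
  shows "\<not> prefix (w @ e) (U @ z)"
proof
  assume pre: "prefix (w @ e) (U @ z)"
  obtain w' where w': "w = w' @ e" using e(3) by (auto simp: suffix_def)
  have lw: "length w = p" using z w by simp
  have zw: "take p z @ z = z @ w" unfolding w using has_period_drop_take[OF z(1)] z by simp
  have per_zw: "has_period p (z @ w)"
  proof -
    have "has_period (length (take p z)) (take p z @ z)"
      by (rule has_period_conjugate[where b = w]) (use z has_period_pos[OF z(1)] zw in auto)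
    then show ?thesis using zw z by (simp add: min_absorb2)
  qed
  note left = junction_not_periodic_left[OF J z]
  have "prefix w (U @ z)" using pre by (auto simp: prefix_def)
  then consider "prefix U w" | g where "U = w @ g"
    using prefix_same_cases[of w "U @ z" U] by (auto simp: prefix_def)
  then show False
  proof cases
    case 1
    then obtain g where "w = U @ g" by (auto simp: prefix_def)
    then show False using left per_zw has_period_prefix[of p "z @ U" g] by simp
  next
    case U_eq: 2
    then have "prefix e (g @ z)" using pre by simp
    then consider "prefix e g" | e' where "e = g @ e'"
      unfolding prefix_append by blast
    then show False
    proof cases
      case 1
      then obtain g' where "g = e @ g'" by (auto simp: prefix_def)
      then have "U = w' @ e @ e @ g'" using U_eq w' by simp
      then show False using no_periodicityD[OF U] e by blast
    next
      case long: 2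
      obtain B where B: "g @ z = e @ B" using \<open>prefix e (g @ z)\<close> by (auto simp: prefix_def)
      have whole: "z @ U @ z = (z @ w') @ e @ e @ B" using U_eq B w' by simp
      then consider "has_period p ((z @ w') @ e @ e)" | "has_period p (e @ e @ B)"
        using J e unfolding junction_def by blast
      then show False
      proof cases
        case 1
        have "(z @ w') @ e @ e = (z @ U) @ e'" using U_eq long w' by simp
        then show False using 1 left has_period_prefix by metis
      next
        case 2
        then have "has_period p (g @ z)" using B has_period_suffix by metis
        then show False using junction_no_overlap_rev[of p z w g] J U_eq z w by simp
      qed
    qed
  qed
qed

text \<open>
  The mirror image of \<open>junction_right\<close>.
\<close>

lemma junction_left:
  assumes J: "junction p z U" and U: "no_periodicity U" and z: "has_period p z" "2 * p \<le> length z"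
    and e: "e \<noteq> []" "length e \<le> p" "prefix e z"
  shows "\<not> suffix (e @ take p z) (z @ U)"
proof
  assume "suffix (e @ take p z) (z @ U)"
  then have "prefix (rev (take p z) @ rev e) (rev U @ rev z)"
    by (simp only: suffix_to_prefix rev_append)
  moreover have "prefix e (take p z)"
    using prefix_length_prefix[OF e(3) take_is_prefix] e(2) z by simp
  then have "suffix (rev e) (rev (take p z))" by (simp add: suffix_to_prefix)
  moreover have "rev (take p z) = drop (length (rev z) - p) (rev z)"
    using z by (simp add: drop_rev)
  ultimately show False
    using junction_right[OF junction_rev[OF J] no_periodicity_rev[OF U] has_period_rev[OF z(1)], of "rev (take p z)" "rev e"] z e
    by simp
qed

lemma side_word_split:
  assumes "1 \<le> j" "Suc j < n"
  shows "\<exists>ys. side_word w z n = side_word w z j @ z @ w (Suc j) @ z @ ys"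
proof -
  have "\<exists>ys. side_word w z n = side_word w z (Suc j) @ z @ ys"
    using Suc_leI[OF assms(2)]
  proof (induction n rule: dec_induct)
    case base
    then show ?case by (auto simp: side_word_Suc)
  next
    case (step m)
    then show ?case by (auto simp: side_word_Suc)
  qed
  then show ?thesis using assms by (auto simp: side_word_Suc)
qed

lemma subword_at_append:
  "subword_at (A @ B @ C) (length A, length A + length B) = B"
  by (simp add: subword_at_def)

text \<open>
  A run is the largest, not only a maximal, stretch of period \<open>p\<close> around its occurrence once
  that occurrence has length at least \<open>p\<close>.
\<close>

lemma is_run_absorbs:
  assumes r: "is_run W p o1 r" and I: "is_occ W I" "occ_within o1 I" "has_period p (subword_at W I)"
    and len: "fst o1 + p \<le> snd o1"
  shows "occ_within I r"
proof -
  obtain r' where r': "is_run W p I r'" using is_run_ex[OF I(1,3)] by blast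
  have trans: "occ_within o1 r''" if "occ_within I r''" for r''
    using I(2) that by (auto simp: occ_within_def)
  have "is_run W p o1 r'" using r' trans unfolding is_run_def by blast
  then have "r' = r" using is_run_unique[of p "snd o1" "fst o1" W r' r] r len by simp
  then show ?thesis using r' by (simp add: is_run_def)
qed

text \<open>
  A run \<open>R\<^sub>i\<close> that contains a square also contains the \<open>i\<close>-th appearance of \<open>z\<close>.  If this appearance
  is not to the right of the left \<open>z\<close> of the junction, the run covers everything from the start of the junction to
  the end of the square; otherwise it covers everything from the square to the end of the junction.
\<close>

lemma periodicity_contained_junction:
  assumes C: "periodicity_contained w z n" and z: "z \<noteq> []" and k: "2 \<le> k" "k < n"
  shows "junction (min_period z) z (w k)"
proof -
  define p where "p = min_period z"
  define W where "W = side_word w z n"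
  define R where "R = (\<lambda>j. run W p (displayed w z j))"
  define b where "b = (\<lambda>j. length (side_word w z j))"
  note mp = min_period[OF z, folded p_def]
  have b_mono: "b i \<le> b j" if "1 \<le> i" "i \<le> j" for i j
    using that(2,1) by (induction j rule: dec_induct) (auto simp: b_def side_word_Suc)
  have inj: "inj_on R {1..<n}"
    and sq: "\<And>o1 \<alpha>. is_occ W o1 \<Longrightarrow> \<alpha> \<noteq> [] \<Longrightarrow> subword_at W o1 = \<alpha> @ \<alpha> \<Longrightarrow> \<exists>j\<in>{1..<n}. occ_within o1 (R j)"
    using C unfolding periodicity_contained_def Let_def R_def W_def p_def by blast+
  have disp: "displayed w z j = (b j, b j + length z)" for j
    by (simp add: displayed_def b_def Let_def)
  have run: "is_run W p (b j, b j + length z) (R j)" if "1 \<le> j" "j < n" for j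
    using is_run_run[of W "displayed w z j" p] displayed_correct[OF that, of w z] mp
    unfolding R_def W_def disp by simp
  define j where "j = k - 1"
  have j: "1 \<le> j" "Suc j < n" "k = Suc j" using k by (auto simp: j_def)
  obtain ys where W: "W = side_word w z j @ z @ w k @ z @ ys"
    using side_word_split[OF j(1,2), of w z] j(3) unfolding W_def by auto
  have bk: "b k = b j + length z + length (w k)"
    using j by (simp add: b_def side_word_Suc)
  have part: "has_period p B'" if "W = A' @ B' @ C'" "fst (R i) \<le> length A'" "length A' + length B' \<le> snd (R i)"
      "1 \<le> i" "i < n" for A' B' C' i
  proof -
    have o: "is_occ W (fst (R i), snd (R i))" and
      per: "has_period p (subword_at W (fst (R i), snd (R i)))"
      using run[OF that(4,5)] by (auto simp: is_run_def)
    have o': "is_occ W (length A', length A' + length B')" using that(1) by (simp add: is_occ_def)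
    have "has_period p (subword_at W (length A', length A' + length B'))"
      using per that(2,3) unfolding has_period_subword_at[OF o] has_period_subword_at[OF o'] by auto
    then show ?thesis unfolding that(1) subword_at_append .
  qed
  have "\<not> has_period p (z @ w k @ z)"
  proof
    assume per: "has_period p (z @ w k @ z)"
    let ?I = "(b j, b k + length z)"
    have occ: "is_occ W ?I" using W bk by (simp add: is_occ_def b_def)
    have "subword_at W ?I = z @ w k @ z"
      using W bk by (simp add: subword_at_def b_def)
    then have perI: "has_period p (subword_at W ?I)" using per by simp
    have "occ_within ?I (R j)"
      using is_run_absorbs[OF run occ _ perI] j mp bk by (auto simp: occ_within_def)
    moreover have "occ_within ?I (R k)"
      using is_run_absorbs[OF run occ _ perI, of k] k mp bk by (auto simp: occ_within_def)
    ultimately have "is_run W p ?I (R j)" "is_run W p ?I (R k)"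
      using run[of j] run[of k] j k by (auto simp: is_run_def)
    then have "R j = R k" using is_run_unique[of p "b k + length z" "b j" W] mp bk by simp
    then show False using inj_onD[OF inj, of j k] j k by simp
  qed
  moreover have "has_period p (A @ s @ s) \<or> has_period p (s @ s @ B)"
    if eq: "z @ w k @ z = A @ s @ s @ B" and s: "s \<noteq> []" for A s B
  proof -
    let ?o = "(b j + length A, b j + length A + length (s @ s))"
    have W': "W = (side_word w z j @ A) @ (s @ s) @ (B @ ys)" using W eq by (metis append.assoc)
    have "subword_at W ?o = s @ s"
      using subword_at_append[of "side_word w z j @ A" "s @ s" "B @ ys"] unfolding W'[symmetric]
      by (simp add: b_def)
    moreover have "is_occ W ?o" using W' by (simp add: is_occ_def b_def)
    ultimately obtain i where i: "1 \<le> i" "i < n" and wi: "occ_within ?o (R i)"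
      using sq[of ?o s] s by auto
    have ri: "fst (R i) \<le> b i" "b i + length z \<le> snd (R i)"
      using run[OF i] by (auto simp: is_run_def occ_within_def)
    have len: "length A + length s + length s + length B = length z + length (w k) + length z"
      using arg_cong[OF eq, of length] by simp
    show ?thesis
    proof (cases "i \<le> j")
      case True
      then have "fst (R i) \<le> b j" using ri b_mono[OF i(1)] by (meson order.trans)
      then have "has_period p (A @ s @ s)"
        using wi W' by (intro part[of "side_word w z j" "A @ s @ s" "B @ ys" i] i)
          (auto simp: occ_within_def b_def)
      then show ?thesis ..
    next
      case False
      then have "b k + length z \<le> snd (R i)" using ri b_mono[of k i] j i by simp
      then have "has_period p (s @ s @ B)"
        using wi W' bk len by (intro part[of "side_word w z j @ A" "s @ s @ B" ys i] i)
          (auto simp: occ_within_def b_def)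
      then show ?thesis ..
    qed
  qed
  ultimately show ?thesis unfolding junction_def p_def by blast
qed

section \<open>Top words and division in the free algebra\<close>

lemma free_alg_add_self [simp]: "(x :: 'a free_alg) + x = 0"
  by (rule poly_mapping_eqI) (simp add: lookup_add)

lemma free_alg_add_self_left [simp]: "(x :: 'a free_alg) + (x + y) = y"
  by (simp add: add.assoc[symmetric])

lemma free_alg_add_eq_0_iff: "(x :: 'a free_alg) + y = 0 \<longleftrightarrow> x = y"
proof
  assume "x + y = 0"
  then have "x + (x + y) = x + 0" by simp
  then show "x = y" by simp
qed simp

lemma lookup_free_alg: "Poly_Mapping.lookup (x :: 'a free_alg) w = (if w \<in> Poly_Mapping.keys x then 1 else 0)"
  by (simp add: in_keys_iff)

text \<open>
  The support of the top homogeneous part.  Over the field with two elements a homogeneous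
  element is determined by its support, so no coefficients need to be carried along.
\<close>

definition tops :: "'a free_alg \<Rightarrow> 'a list set" where
  "tops x = {w \<in> Poly_Mapping.keys x. length w = deg x}"

text \<open>
  The zero element counts as lower than everything, as the remainder of a division should.
\<close>

definition lower :: "'a free_alg \<Rightarrow> 'a free_alg \<Rightarrow> bool" where
  "lower y x \<longleftrightarrow> y = 0 \<or> deg y < deg x"

lemma keys_length_le_deg: "w \<in> Poly_Mapping.keys x \<Longrightarrow> length w \<le> deg x"
  by (auto simp: deg_def)

lemma tops_length: "w \<in> tops x \<Longrightarrow> length w = deg x"
  by (simp add: tops_def)

lemma finite_tops [simp]: "finite (tops x)"
  by (simp add: tops_def)

lemma deg_tops_eqI:
  assumes "w \<in> Poly_Mapping.keys x" "length w = n" "\<And>v. v \<in> Poly_Mapping.keys x \<Longrightarrow> length v \<le> n"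
  shows "deg x = n"
proof -
  have "x \<noteq> 0" using assms(1) by auto
  moreover have "Max (length ` Poly_Mapping.keys x) = n" using assms by (intro Max_eqI) auto
  ultimately show ?thesis by (simp add: deg_def)
qed

lemma tops_nonempty: assumes "x \<noteq> 0" shows "\<exists>w. w \<in> tops x"
proof -
  have "Poly_Mapping.keys x \<noteq> {}" using assms by simp
  then have "deg x \<in> length ` Poly_Mapping.keys x"
    unfolding deg_def using assms by (simp only: if_False) (rule Max_in, auto)
  then show ?thesis by (auto simp: tops_def)
qed

lemma tops_zero [simp]: "tops 0 = {}"
  by (simp add: tops_def)

lemma tops_nonzero: "w \<in> tops x \<Longrightarrow> x \<noteq> 0"
  using tops_zero by blast

lemma tops_singleton_deg: "tops x = {w} \<Longrightarrow> deg x = length w"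
  using tops_length[of w x] by simp

lemma tops_singleton_nonzero: "tops x = {w} \<Longrightarrow> x \<noteq> 0"
  by (rule tops_nonzero[of w]) simp

lemma tops_one [simp]: "tops 1 = {[]}"
proof -
  have "deg (1 :: 'a free_alg) = 0" by (simp add: deg_def zero_list_def)
  then show ?thesis by (auto simp: tops_def zero_list_def)
qed

lemma tops_add_lower:
  assumes "x \<noteq> 0" "lower y x"
  shows "tops (x + y) = tops x"
proof (cases "y = 0")
  case False
  then have less: "deg y < deg x" using assms by (simp add: lower_def)
  have iff: "w \<in> Poly_Mapping.keys (x + y) \<longleftrightarrow> w \<in> Poly_Mapping.keys x" if "length w \<ge> deg x" for w
  proof -
    have "w \<notin> Poly_Mapping.keys y"
    proof
      assume "w \<in> Poly_Mapping.keys y"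
      then show False using keys_length_le_deg[of w y] less that by linarith
    qed
    then have "Poly_Mapping.lookup y w = 0" by (simp only: in_keys_iff not_not)
    then show ?thesis by (simp only: in_keys_iff lookup_add add_0_right)
  qed
  obtain w where w: "w \<in> tops x" using tops_nonempty assms(1) by blast
  have "deg (x + y) = deg x"
  proof (rule deg_tops_eqI[of w])
    show "w \<in> Poly_Mapping.keys (x + y)" "length w = deg x" using w iff[of w] by (simp_all add: tops_def)
    fix v assume "v \<in> Poly_Mapping.keys (x + y)"
    then have "v \<in> Poly_Mapping.keys x \<or> v \<in> Poly_Mapping.keys y" using keys_add[of x y] by blast
    then show "length v \<le> deg x"
      using keys_length_le_deg[of v x] keys_length_le_deg[of v y] less by linarith
  qed
  then show ?thesis unfolding tops_def using iff by (intro Collect_cong) auto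
qed simp

lemma deg_eq_of_tops_eq: "tops x = tops y \<Longrightarrow> x \<noteq> 0 \<Longrightarrow> deg x = deg y"
  using tops_nonempty[of x] tops_length[of _ x] tops_length[of _ y] by metis

lemma lower_add_of_tops_eq:
  assumes "tops x = tops y" "x \<noteq> 0"
  shows "lower (x + y) x"
proof (rule ccontr)
  assume "\<not> lower (x + y) x"
  then have nz: "x + y \<noteq> 0" and ge: "deg x \<le> deg (x + y)" by (auto simp: lower_def)
  obtain w where w: "w \<in> tops (x + y)" using tops_nonempty[OF nz] by blast
  have d: "deg x = deg y" using deg_eq_of_tops_eq assms by blast
  have "w \<in> Poly_Mapping.keys x \<or> w \<in> Poly_Mapping.keys y" and w': "w \<in> Poly_Mapping.keys (x + y)"
    using w keys_add[of x y] by (auto simp: tops_def)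
  moreover have "deg x \<le> length w" using w ge by (simp add: tops_length)
  ultimately have "w \<in> tops x \<or> w \<in> tops y"
    using keys_length_le_deg[of w x] keys_length_le_deg[of w y] d
    unfolding tops_def mem_Collect_eq by linarith
  then have "w \<in> Poly_Mapping.keys x" "w \<in> Poly_Mapping.keys y" using assms by (auto simp: tops_def)
  then have "Poly_Mapping.lookup x w + Poly_Mapping.lookup y w = 0" by (simp add: lookup_free_alg)
  then have "Poly_Mapping.lookup (x + y) w = 0" by (simp only: lookup_add)
  then show False using w' by (simp add: in_keys_iff)
qed

text \<open>
  A word of length \<open>|a| + |b|\<close> has only one factorization into words of lengths at most \<open>|a|\<close> and
  \<open>|b|\<close>, so the convolution sum has a single term.
\<close>

lemma lookup_mult_append:
  assumes a: "deg x \<le> length a" and b: "deg y \<le> length b"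
  shows "Poly_Mapping.lookup (x * y) (a @ b) = Poly_Mapping.lookup x a * Poly_Mapping.lookup y b"
proof -
  have inner: "(\<Sum>q. Poly_Mapping.lookup y q when a @ b = a + q) = Poly_Mapping.lookup y b"
  proof -
    have "(\<lambda>q. Poly_Mapping.lookup y q when a @ b = a + q) = (\<lambda>q. Poly_Mapping.lookup y q when b = q)"
      by (auto simp: plus_list_def)
    then show ?thesis by (simp only: Sum_any_when_equal')
  qed
  define F where "F = (\<lambda>l. Poly_Mapping.lookup x l * (\<Sum>q. Poly_Mapping.lookup y q when a @ b = l + q))"
  have "F l = (F l when a = l)" for l
  proof (cases "a = l")
    case False
    have "Poly_Mapping.lookup x l = 0 \<or> (\<forall>q. (Poly_Mapping.lookup y q when a @ b = l + q) = 0)"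
    proof (rule ccontr)
      assume "\<not> ?thesis"
      then obtain q where "l \<in> Poly_Mapping.keys x" "q \<in> Poly_Mapping.keys y" and eq: "a @ b = l @ q"
        by (auto simp: plus_list_def in_keys_iff when_def split: if_splits)
      then have "length l \<le> length a" "length q \<le> length b"
        using a b keys_length_le_deg[of l x] keys_length_le_deg[of q y] by linarith+
      moreover have "length a + length b = length l + length q"
        using arg_cong[OF eq, of length] by simp
      ultimately have "length a = length l" by linarith
      then show False using eq False by simp
    qed
    then show ?thesis using False by (auto simp: F_def)
  qed simp
  then have "F = (\<lambda>l. F l when a = l)" by (rule ext)
  then have "Sum_any F = (\<Sum>l. F l when a = l)" by (rule arg_cong)
  also have "\<dots> = F a" by (rule Sum_any_when_equal')
  also have "\<dots> = Poly_Mapping.lookup x a * Poly_Mapping.lookup y b" by (simp only: F_def inner)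
  finally show ?thesis by (simp only: lookup_mult F_def)
qed

lemma append_in_keys_mult:
  assumes "length a = deg x" "length b = deg y"
  shows "a @ b \<in> Poly_Mapping.keys (x * y) \<longleftrightarrow> a \<in> Poly_Mapping.keys x \<and> b \<in> Poly_Mapping.keys y"
  unfolding in_keys_iff using lookup_mult_append[of x a y b] assms by simp

lemma free_alg_mult_nonzero:
  fixes x y :: "'a free_alg"
  assumes "x \<noteq> 0" "y \<noteq> 0"
  shows "x * y \<noteq> 0"
proof -
  obtain a b where ab: "a \<in> tops x" "b \<in> tops y" using tops_nonempty assms by blast
  then have "a @ b \<in> Poly_Mapping.keys (x * y)" by (simp add: append_in_keys_mult tops_def)
  then have "Poly_Mapping.keys (x * y) \<noteq> {}" by blast
  then show ?thesis by (simp only: keys_eq_empty not_False_eq_True)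
qed

lemma deg_mult:
  assumes "x \<noteq> 0" "y \<noteq> 0"
  shows "deg (x * y) = deg x + deg y"
proof -
  obtain a b where ab: "a \<in> tops x" "b \<in> tops y" using tops_nonempty assms by blast
  then have k: "a @ b \<in> Poly_Mapping.keys (x * y)" by (simp add: append_in_keys_mult tops_def)
  show ?thesis
  proof (rule deg_tops_eqI[OF k])
    show "length (a @ b) = deg x + deg y" using ab by (simp add: tops_length)
    fix v assume "v \<in> Poly_Mapping.keys (x * y)"
    then obtain c d where "v = c @ d" "c \<in> Poly_Mapping.keys x" "d \<in> Poly_Mapping.keys y"
      using keys_mult[of x y] by (auto simp: plus_list_def)
    then show "length v \<le> deg x + deg y"
      using keys_length_le_deg[of c x] keys_length_le_deg[of d y] by simp
  qed
qed

text \<open>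
  Top words multiply without cancellation, since all of the left factors have the same length.
  This makes the algebra a domain in which the degree is additive.
\<close>

lemma tops_mult:
  assumes "x \<noteq> 0" "y \<noteq> 0"
  shows "w \<in> tops (x * y) \<longleftrightarrow> (\<exists>a\<in>tops x. \<exists>b\<in>tops y. w = a @ b)"
proof
  assume w: "w \<in> tops (x * y)"
  let ?a = "take (deg x) w" and ?b = "drop (deg x) w"
  have la: "length ?a = deg x" and lb: "length ?b = deg y"
    using w deg_mult[OF assms] by (auto simp: tops_def)
  have "?a @ ?b \<in> Poly_Mapping.keys (x * y)" using w by (simp add: tops_def)
  then have "?a \<in> tops x" "?b \<in> tops y"
    unfolding append_in_keys_mult[OF la lb] using la lb by (simp_all only: tops_def mem_Collect_eq)
  moreover have "w = ?a @ ?b" by simp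
  ultimately show "\<exists>a\<in>tops x. \<exists>b\<in>tops y. w = a @ b" by blast
next
  assume "\<exists>a\<in>tops x. \<exists>b\<in>tops y. w = a @ b"
  then obtain a b where "a \<in> tops x" "b \<in> tops y" and w: "w = a @ b" by blast
  then show "w \<in> tops (x * y)"
    using append_in_keys_mult[of a x b y] deg_mult[OF assms] unfolding w by (simp add: tops_def)
qed

lemma free_alg_mult_eq_0_iff [simp]: "(x :: 'a free_alg) * y = 0 \<longleftrightarrow> x = 0 \<or> y = 0"
proof
  show "x = 0 \<or> y = 0" if "x * y = 0" using free_alg_mult_nonzero[of x y] that by blast
  show "x * y = 0" if "x = 0 \<or> y = 0" using that by (elim disjE) simp_all
qed

lemma free_alg_mult_left_cancel [simp]: "(a :: 'a free_alg) * x = a * y \<longleftrightarrow> a = 0 \<or> x = y"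
proof -
  have "a * x = a * y \<longleftrightarrow> a * (x + y) = 0"
    by (simp only: distrib_left free_alg_add_eq_0_iff)
  then show ?thesis by (simp only: free_alg_mult_eq_0_iff free_alg_add_eq_0_iff)
qed

lemma tops_mult_singleton:
  assumes "tops x = {a}" "tops y = {b}"
  shows "tops (x * y) = {a @ b}"
proof -
  have "w \<in> tops (x * y) \<longleftrightarrow> w = a @ b" for w
    using tops_mult[OF tops_singleton_nonzero[OF assms(1)] tops_singleton_nonzero[OF assms(2)]]
    by (simp add: assms)
  then show ?thesis by auto
qed

lemma tops_mult_mono: "x \<noteq> 0 \<Longrightarrow> y \<noteq> 0 \<Longrightarrow> a \<in> tops x \<Longrightarrow> b \<in> tops y \<Longrightarrow> a @ b \<in> tops (x * y)"
  by (subst tops_mult) blast+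

lemma tops_add_one:
  fixes x :: "'a free_alg"
  assumes "tops x = {w}" "w \<noteq> []"
  shows "tops (x + 1) = {w}"
proof -
  have "lower 1 x" unfolding lower_def
    using tops_singleton_deg[OF assms(1)] tops_singleton_deg[of "1 :: 'a free_alg" "[]"] assms(2) by simp
  then show ?thesis 
    using tops_add_lower[OF tops_singleton_nonzero[OF assms(1)]] assms(1) by simp
qed

lemma deg_0_eq_one:
  assumes "x \<noteq> 0" "deg x = 0"
  shows "x = 1"
proof (rule poly_mapping_eqI)
  fix w
  have "v \<in> Poly_Mapping.keys x \<Longrightarrow> v = []" for v using keys_length_le_deg[of v x] assms by simp
  moreover obtain v where "v \<in> Poly_Mapping.keys x" using tops_nonempty[OF assms(1)] by (auto simp: tops_def)
  ultimately have "w \<in> Poly_Mapping.keys x \<longleftrightarrow> w = []" by blast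
  then show "Poly_Mapping.lookup x w = Poly_Mapping.lookup 1 w"
    by (simp add: lookup_free_alg zero_list_def)
qed

lemma tops_top_monomial:
  assumes "is_monomial (top_part x)"
  shows "tops x = {top_word x}"
proof -
  obtain w where w: "top_part x = Poly_Mapping.single w 1" using assms by (auto simp: is_monomial_def)
  have "Poly_Mapping.keys (top_part x) = tops x"
  proof -
    have "Poly_Mapping.lookup (top_part x) v = (if v \<in> tops x then 1 else 0)" for v
      unfolding top_part_def lookup_sum
      by (auto simp: lookup_single when_def tops_def lookup_free_alg)
    then show ?thesis by (auto simp: in_keys_iff split: if_splits)
  qed
  then show ?thesis using w top_word_eqI[OF w] by simp
qed

lemma keys_sum_words:
  assumes "finite S"
  shows "Poly_Mapping.keys (\<Sum>w\<in>S. Poly_Mapping.single w (1 :: bit)) = S"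
proof -
  have "Poly_Mapping.lookup (\<Sum>w\<in>S. Poly_Mapping.single w (1 :: bit)) v = (if v \<in> S then 1 else 0)" for v
    using assms by (auto simp: lookup_sum lookup_single when_def sum.delta)
  then show ?thesis by (auto simp: in_keys_iff split: if_splits)
qed

text \<open>
  The weak algorithm of the free algebra: if \<open>B\<close> and \<open>c\<close> have a common right multiple, then \<open>B\<close>
  can be divided by \<open>c\<close> on the left.  As long as \<open>B\<close> is not lower than \<open>c\<close>, comparing top words in
  \<open>B Q = c Q'\<close> shows that each top word of \<open>B\<close> begins with \<open>\<gamma>\<close>, so its top part can be
  removed by a multiple of \<open>c\<close>, which keeps the common multiple.
\<close>

lemma left_division:
  assumes c: "tops c = {\<gamma>}" and Q: "Q \<noteq> 0"
  shows "B * Q = c * Q' \<Longrightarrow> \<exists>q r. B = c * q + r \<and> lower r c"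
proof (induction "deg B" arbitrary: B Q' rule: less_induct)
  case less
  note c0 = tops_singleton_nonzero[OF c] and dc = tops_singleton_deg[OF c]
  show ?case
  proof (cases "lower B c")
    case True
    then show ?thesis by (intro exI[of _ 0] exI[of _ B]) simp
  next
    case False
    then have B: "B \<noteq> 0" and ge: "length \<gamma> \<le> deg B" using dc by (auto simp: lower_def)
    have Q': "Q' \<noteq> 0"
    proof
      assume "Q' = 0"
      then have "B * Q = 0" using less.prems by simp
      then show False using B Q by simp
    qed
    have pre: "\<gamma> @ drop (length \<gamma>) a = a" if a: "a \<in> tops B" for a
    proof -
      obtain b where b: "b \<in> tops Q" using tops_nonempty[OF Q] by blast
      then have "a @ b \<in> tops (c * Q')" using a B Q less.prems by (metis tops_mult_mono)
      then obtain b' where "a @ b = \<gamma> @ b'" using tops_mult[OF c0 Q'] c by auto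
      then have "take (length \<gamma>) (a @ b) = \<gamma>" by simp
      then have "take (length \<gamma>) a = \<gamma>" using ge tops_length[OF a] by simp
      then show ?thesis using append_take_drop_id[of "length \<gamma>" a] by simp
    qed
    define S where "S = drop (length \<gamma>) ` tops B"
    define q where "q = (\<Sum>w\<in>S. Poly_Mapping.single w (1 :: bit))"
    have kq: "Poly_Mapping.keys q = S" unfolding q_def by (rule keys_sum_words) (simp add: S_def)
    have lS: "length v = deg B - length \<gamma>" if "v \<in> S" for v
      using that by (auto simp: S_def tops_length)
    obtain a where a: "a \<in> tops B" using tops_nonempty[OF B] by blast
    then have aS: "drop (length \<gamma>) a \<in> S" by (simp add: S_def)
    have "deg q = deg B - length \<gamma>"
      by (rule deg_tops_eqI[of "drop (length \<gamma>) a"]) (use kq lS aS tops_length[OF a] in auto)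
    then have tq: "tops q = S" using kq lS by (auto simp: tops_def)
    have q0: "q \<noteq> 0" using tq aS tops_nonzero by blast
    have "tops (c * q) = tops B"
      using tops_mult[OF c0 q0] tq c pre by (auto simp: S_def)
    then have low: "lower (B + c * q) B" using lower_add_of_tops_eq[of B "c * q"] B by simp
    show ?thesis
    proof (cases "B + c * q = 0")
      case True
      then show ?thesis
        by (intro exI[of _ q] exI[of _ 0]) (simp add: free_alg_add_eq_0_iff lower_def)
    next
      case False
      then have "deg (B + c * q) < deg B" using low by (simp add: lower_def)
      moreover have "(B + c * q) * Q = c * (Q' + q * Q)"
        using less.prems by (simp add: distrib_left distrib_right mult.assoc)
      ultimately obtain q1 r where qr: "B + c * q = c * q1 + r" "lower r c"
        using less.hyps by blast
      have "B = c * q + (B + c * q)"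
        using free_alg_add_self_left[of "c * q" B] by (simp only: add.commute)
      also have "\<dots> = c * (q + q1) + r" unfolding qr(1) by (simp add: distrib_left add.assoc)
      finally show ?thesis using qr(2) by blast
    qed
  qed
qed

section \<open>Exact division forced by a periodic top word\<close>

text \<open>
  Dropping whole periods shortens a prefix of \<open>z\<close> to length at most \<open>p\<close> while it stays both a prefix of \<open>z\<close>
  and a suffix of the word that it came from.
\<close>

lemma periodic_prefix_reduce:
  assumes "has_period p z" "prefix e z" "e \<noteq> []"
  shows "\<exists>e'. e' \<noteq> [] \<and> length e' \<le> p \<and> suffix e' e \<and> prefix e' z"
proof -
  let ?k = "(length e - 1) div p"
  define e' where "e' = drop (?k * p) e"
  have p: "0 < p" using assms(1) by (rule has_period_pos)
  have mod: "length e - 1 = ?k * p + (length e - 1) mod p" by simp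
  have less: "(length e - 1) mod p < p" using p by simp
  have le: "0 < length e" using assms(3) by simp
  have len: "length e' = Suc ((length e - 1) mod p)"
    unfolding e'_def length_drop using mod le by linarith
  have el: "length e \<le> length z" using assms(2) by (rule prefix_length_le)
  have ke: "?k * p < length e" using mod le less by linarith
  have "e' = take (length e') z"
  proof (rule nth_equalityI)
    show "length e' = length (take (length e') z)" using el unfolding e'_def by simp
    fix i assume i: "i < length e'"
    then have ik: "i + ?k * p < length e" unfolding e'_def by simp
    have "e' ! i = e ! (i + ?k * p)"
      using ke by (simp add: e'_def add.commute)
    also have "\<dots> = z ! (i + ?k * p)" using assms(2) ik by (auto simp: prefix_def nth_append)
    also have "\<dots> = z ! i" using has_period_nth_mult[OF assms(1), of i ?k] ik el by simp
    finally show "e' ! i = take (length e') z ! i" using i by simp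
  qed
  then have "prefix e' z" by (metis take_is_prefix)
  moreover have "suffix e' e" unfolding e'_def by (rule suffix_drop)
  moreover have "e' \<noteq> []" using len by auto
  moreover have "length e' \<le> p" using len less by simp
  ultimately show ?thesis by blast
qed

lemma periodic_suffix_reduce:
  assumes "has_period p z" "suffix e z" "e \<noteq> []"
  shows "\<exists>e'. e' \<noteq> [] \<and> length e' \<le> p \<and> prefix e' e \<and> suffix e' z"
proof -
  obtain f where f: "f \<noteq> []" "length f \<le> p" "suffix f (rev e)" "prefix f (rev z)"
    using periodic_prefix_reduce[OF has_period_rev[OF assms(1)], of "rev e"] assms(2,3)
    by (auto simp: suffix_to_prefix)
  then show ?thesis by (intro exI[of _ "rev f"]) (simp add: suffix_to_prefix)
qed

text \<open>
  The word \<open>z\<close> stands for the top word of the given solution; \<open>root\<close> and \<open>coroot\<close> below are the words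
  called \<open>\<rho>\<close> and \<open>w\<close> in the comments.
\<close>

locale least_period =
  fixes z :: "'a list" and p :: nat
  assumes period: "has_period p z"
    and least: "d < p \<Longrightarrow> \<not> has_period d z"
    and period_le: "p \<le> length z"
begin

abbreviation "root \<equiv> take p z"
abbreviation "coroot \<equiv> drop (length z - p) z"

lemma period_pos: "0 < p"
  using period by (rule has_period_pos)

lemma length_root: "length root = p"
  using period_le by simp

lemma length_coroot: "length coroot = p"
  using period_le by simp

lemma root_shift: "root @ z = z @ coroot"
  using has_period_drop_take[OF period period_le] .

text \<open>
  Comparing top words in \<open>r x Y = B x Y'\<close> gives \<open>\<beta> = r\<^sub>0 \<kappa>\<close> with \<open>\<kappa>\<close> a period of \<open>z\<close>, hence a
  power of \<open>\<rho>\<close>; the condition on \<open>\<beta>\<close> leaves only \<open>\<kappa> = \<rho>\<close>.  A nonzero remainder \<open>r'\<close> of the division of \<open>B\<close>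
  by \<open>r\<close> would satisfy an equation of the same kind with \<open>r\<close> in the role of \<open>B\<close>, so that \<open>r\<^sub>0 = a' e\<close> with \<open>e\<close> a
  prefix of \<open>z\<close>, and \<open>\<beta>\<close> would end in \<open>e \<rho>\<close>.  The minimum in the length condition allows for the
  first use, at which \<open>p\<close> is not yet bounded by the degrees of the coefficients.
\<close>

lemma left_factor_of_longer:
  fixes x r B Y Y' :: "'a free_alg"
  assumes x: "tops x = {z}" and B: "tops B = {\<beta>}" and r: "r \<noteq> 0" "deg r < deg B" and Y: "Y \<noteq> 0"
    and eq: "r * (x * Y) = B * (x * Y')"
    and len: "length \<beta> + min p (length \<beta>) \<le> length z"
    and free: "\<And>e. e \<noteq> [] \<Longrightarrow> length e \<le> p \<Longrightarrow> prefix e z \<Longrightarrow> \<not> suffix (e @ root) \<beta>"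
  shows "\<exists>\<sigma>. B = r * \<sigma> \<and> tops \<sigma> = {root}"
proof -
  note nz = tops_singleton_nonzero[OF x] tops_singleton_nonzero[OF B]
  have dB: "deg B = length \<beta>" using tops_singleton_deg[OF B] .
  have xY: "x * Y \<noteq> 0" using nz Y by simp
  then have "B * (x * Y') \<noteq> 0" unfolding eq[symmetric] using r(1) by simp
  then have Y': "Y' \<noteq> 0" and xY': "x * Y' \<noteq> 0" by auto
  obtain y where y: "y \<in> tops Y" using tops_nonempty[OF Y] by blast
  have align: "\<exists>y'\<in>tops Y'. a @ z @ y = \<beta> @ z @ y'" if "a \<in> tops r" for a
  proof -
    have "z @ y \<in> tops (x * Y)" using tops_mult_mono[OF nz(1) Y _ y] x by simp
    then have "a @ z @ y \<in> tops (B * (x * Y'))"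
      unfolding eq[symmetric] using tops_mult_mono[OF r(1) xY that] by simp
    then show ?thesis by (auto simp: tops_mult[OF nz(2) xY'] tops_mult[OF nz(1) Y'] B x)
  qed
  define r0 where "r0 = take (deg r) \<beta>"
  have "a = r0" if a: "a \<in> tops r" for a
  proof -
    obtain y' where "a @ z @ y = \<beta> @ z @ y'" using align[OF a] by blast
    then have "take (deg r) (a @ z @ y) = take (deg r) (\<beta> @ z @ y')" by simp
    then show ?thesis using tops_length[OF a] r(2) dB by (simp add: r0_def)
  qed
  moreover obtain a where a: "a \<in> tops r" using tops_nonempty[OF r(1)] by blast
  ultimately have tr: "tops r = {r0}" by blast
  define \<kappa> where "\<kappa> = drop (deg r) \<beta>"
  have \<beta>: "\<beta> = r0 @ \<kappa>" by (simp add: r0_def \<kappa>_def)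
  have \<kappa>: "\<kappa> \<noteq> []" "length \<kappa> \<le> length \<beta>" using r(2) dB by (simp_all add: \<kappa>_def)
  obtain y' where "r0 @ z @ y = \<beta> @ z @ y'" using align[of r0] tr by blast
  then have zy: "z @ y = \<kappa> @ z @ y'" by (simp add: \<beta>)
  have \<kappa>z: "length \<kappa> \<le> length z" using \<kappa>(2) len by simp
  have "prefix \<kappa> (z @ y)" unfolding zy by simp
  then have pre: "prefix \<kappa> z" using \<kappa>z by (metis prefixI prefix_length_prefix)
  then obtain z1 where z1: "z = \<kappa> @ z1" by (auto simp: prefix_def)
  have "z1 @ y = z @ y'" using zy by (subst (asm) z1) simp
  then have "prefix z1 z" using z1 by (metis length_append le_add2 prefixI prefix_length_prefix)
  then obtain b where "z = z1 @ b" by (auto simp: prefix_def)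
  then have "\<kappa> @ z = z @ b" using z1 by simp
  then have per\<kappa>: "has_period (length \<kappa>) z" using has_period_conjugate[of \<kappa> z b] \<kappa>(1) by simp
  have p\<kappa>: "p \<le> length \<kappa>" using least per\<kappa> by (meson not_le)
  have "p dvd length \<kappa>"
    by (rule minimal_period_dvd[OF period least per\<kappa>]) (use p\<kappa> \<kappa>(2) len in auto)
  then obtain m where m: "length \<kappa> = m * p" by (metis dvd_def mult.commute)
  then have "0 < m" using \<kappa>(1) by (cases m) auto
  then obtain i where "m = Suc i" by (cases m) auto
  then have i: "length \<kappa> = i * p + p" using m by simp
  \<comment> \<open>With \<open>i > 0\<close> the word \<open>\<kappa>\<close> would already end in a forbidden \<open>e \<rho>\<close>.\<close>
  have ends: "\<kappa> = take (i * p) z @ root"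
  proof (rule nth_equalityI)
    show "length \<kappa> = length (take (i * p) z @ root)" using i \<kappa>z by simp
    fix j assume j: "j < length \<kappa>"
    have "\<kappa> ! j = z ! j" using z1 j by (simp add: nth_append)
    also have "\<dots> = (take (i * p) z @ root) ! j"
    proof (cases "j < i * p")
      case True
      then show ?thesis using i \<kappa>z by (simp add: nth_append)
    next
      case False
      then have "z ! (j - i * p) = z ! j"
        using has_period_nth_mult[OF period, of "j - i * p" i] j \<kappa>z by simp
      then show ?thesis using False i \<kappa>z j by (simp add: nth_append)
    qed
    finally show "\<kappa> ! j = (take (i * p) z @ root) ! j" .
  qed
  have free': "\<not> suffix (e @ root) \<beta>" if e: "e \<noteq> []" "prefix e z" for e
  proof
    assume s: "suffix (e @ root) \<beta>"
    obtain e' where e': "e' \<noteq> []" "length e' \<le> p" "suffix e' e" "prefix e' z"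
      using periodic_prefix_reduce[OF period e(2,1)] by blast
    have "suffix (e' @ root) (e @ root)" using e'(3) by (auto simp: suffix_def)
    then have "suffix (e' @ root) \<beta>" using s by (rule suffix_order.trans)
    then show False using free e' by blast
  qed
  have "take (i * p) z = []"
  proof (rule ccontr)
    assume ne: "take (i * p) z \<noteq> []"
    have "suffix (take (i * p) z @ root) \<beta>" unfolding \<beta> ends by (simp add: suffix_def)
    then show False using free'[OF ne take_is_prefix] by blast
  qed
  then have \<beta>_root: "\<beta> = r0 @ root" using \<beta> ends by simp
  obtain \<sigma> r' where div: "B = r * \<sigma> + r'" "lower r' r"
    using left_division[OF tr xY' eq[symmetric]] by blast
  have "r' = 0"
  proof (rule ccontr)
    assume r': "r' \<noteq> 0"
    then have dr': "deg r' < deg r" using div(2) by (simp add: lower_def)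
    define Z where "Z = x * Y + \<sigma> * (x * Y')"
    have "r' * (x * Y') = B * (x * Y') + r * \<sigma> * (x * Y')"
      by (simp add: div(1) distrib_right add.commute[of "r * \<sigma> * (x * Y')"])
    also have "\<dots> = r * Z" by (simp add: eq[symmetric] Z_def distrib_left mult.assoc)
    finally have rZ: "r' * (x * Y') = r * Z" .
    have "r' * (x * Y') \<noteq> 0" using r' xY' by simp
    then have Z: "Z \<noteq> 0" unfolding rZ by auto
    obtain a' where a': "a' \<in> tops r'" using tops_nonempty[OF r'] by blast
    obtain v where v: "v \<in> tops Y'" using tops_nonempty[OF Y'] by blast
    have "z @ v \<in> tops (x * Y')" using tops_mult_mono[OF nz(1) Y' _ v] x by simp
    then have "a' @ z @ v \<in> tops (r * Z)"
      unfolding rZ[symmetric] using tops_mult_mono[OF r' xY' a'] by simp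
    then obtain q where q: "a' @ z @ v = r0 @ q" by (auto simp: tops_mult[OF r(1) Z] tr)
    have la: "length a' < length r0"
      using tops_length[OF a'] dr' tops_singleton_deg[OF tr] by simp
    define e where "e = drop (length a') r0"
    have "take (length a') (r0 @ q) = a'" using q[symmetric] by simp
    then have r0: "r0 = a' @ e" using la append_take_drop_id[of "length a'" r0] by (simp add: e_def)
    have "e \<noteq> []" using la by (simp add: e_def)
    moreover have "prefix e (z @ v)" using q unfolding r0 by simp
    then have "prefix e z"
      using len \<beta> r0 by (intro prefix_length_prefix[of e "z @ v" z]) auto
    moreover have "suffix (e @ root) \<beta>" unfolding \<beta>_root r0 by (simp add: suffix_def)
    ultimately show False using free' by blast
  qed
  then have B\<sigma>: "B = r * \<sigma>" using div by simp
  have \<sigma>: "\<sigma> \<noteq> 0" using B\<sigma> nz(2) by auto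
  have "w = root" if "w \<in> tops \<sigma>" for w
  proof -
    have "r0 @ w \<in> tops B" unfolding B\<sigma> using tops_mult_mono[OF r(1) \<sigma> _ that] tr by simp
    then show ?thesis using B \<beta>_root by simp
  qed
  then have "tops \<sigma> = {root}" using tops_nonempty[OF \<sigma>] by blast
  then show ?thesis using B\<sigma> by blast
qed

text \<open>
  The sum \<open>\<sigma> + s\<close> conjugates as well and has degree below \<open>p\<close>.  If it were not constant, its
  degree would be a period of \<open>z\<close>.
\<close>

lemma conjugators_differ_by_constant:
  fixes x :: "'a free_alg"
  assumes x: "tops x = {z}" and s: "tops s = {root}" "s * x = x * t"
    and \<sigma>: "tops \<sigma> = {root}" "\<sigma> * x = x * \<tau>"
  shows "\<sigma> = s \<and> \<tau> = t \<or> \<sigma> = s + 1 \<and> \<tau> = t + 1"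
proof -
  note x0 = tops_singleton_nonzero[OF x]
  have eq: "(\<sigma> + s) * x = x * (\<tau> + t)" by (simp add: distrib_left distrib_right s \<sigma>)
  show ?thesis
  proof (cases "\<sigma> + s = 0")
    case True
    then have "\<tau> + t = 0" using eq x0 by simp
    then show ?thesis using True by (simp add: free_alg_add_eq_0_iff)
  next
    case False
    have "x * (\<tau> + t) \<noteq> 0" unfolding eq[symmetric] using False x0 by simp
    then have E: "\<tau> + t \<noteq> 0" by auto
    have "lower (\<sigma> + s) \<sigma>"
      using lower_add_of_tops_eq[of \<sigma> s] s \<sigma> tops_singleton_nonzero[OF \<sigma>(1)] by simp
    then have less: "deg (\<sigma> + s) < p"
      using False tops_singleton_deg[OF \<sigma>(1)] length_root by (simp add: lower_def)
    obtain a where a: "a \<in> tops (\<sigma> + s)" using tops_nonempty[OF False] by blast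
    have "a @ z \<in> tops (x * (\<tau> + t))" unfolding eq[symmetric]
      using tops_mult_mono[OF False x0 a] x by simp
    then obtain b where b: "a @ z = z @ b" by (auto simp: tops_mult[OF x0 E] x)
    have "deg (\<sigma> + s) = 0"
    proof (rule ccontr)
      assume "deg (\<sigma> + s) \<noteq> 0"
      then have "has_period (deg (\<sigma> + s)) z"
        using has_period_conjugate[OF _ b] tops_length[OF a] by simp
      then show False using least less by blast
    qed
    then have "\<sigma> + s = 1" using deg_0_eq_one False by blast
    moreover from this have "x * (\<tau> + t) = x * 1" using eq by simp
    then have "\<tau> + t = 1" using x0 by (simp only: free_alg_mult_left_cancel) simp
    ultimately show ?thesis by (metis add.commute free_alg_add_self_left)
  qed
qed

end

text \<open>
  A nonzero remainder \<open>y\<close> of the division of \<open>\<sigma> x\<close> by \<open>x\<close> satisfies \<open>y Y' = x T\<close>, so \<open>X = a e\<close> with \<open>e\<close>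
  nonempty, where top words of \<open>Y'\<close> begin with \<open>e\<close>.  Since top words of \<open>Y\<close> are \<open>w\<close> followed by
  those of \<open>Y'\<close>, they begin with \<open>w e\<close>, and \<open>e\<close> may be shortened to at most \<open>p\<close> letters.
\<close>

lemma right_conjugate_exists:
  fixes x \<sigma> Y Y' :: "'a free_alg"
  assumes x: "tops x = {X}" and X: "has_period p X" "p \<le> length X"
    and \<sigma>: "tops \<sigma> = {\<rho>}" and w: "\<rho> @ X = X @ w" "length w = p"
    and eq: "\<sigma> * (x * Y') = x * Y" and Y': "Y' \<noteq> 0"
    and free: "\<And>e y. e \<noteq> [] \<Longrightarrow> length e \<le> p \<Longrightarrow> suffix e w \<Longrightarrow> y \<in> tops Y \<Longrightarrow> \<not> prefix (w @ e) y"
  shows "\<exists>\<tau>. \<sigma> * x = x * \<tau> \<and> tops \<tau> = {w}"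
proof -
  note nz = tops_singleton_nonzero[OF x] tops_singleton_nonzero[OF \<sigma>]
  have xY': "x * Y' \<noteq> 0" using nz Y' by simp
  have "x * Y \<noteq> 0" unfolding eq[symmetric] using nz xY' by simp
  then have Y: "Y \<noteq> 0" by auto
  have sx: "tops (\<sigma> * x) = {X @ w}" using tops_mult_singleton[OF \<sigma> x] w by simp
  have "\<sigma> * x * Y' = x * Y" using eq by (simp add: mult.assoc)
  then obtain \<tau> y where div: "\<sigma> * x = x * \<tau> + y" "lower y x"
    using left_division[OF x Y'] by blast
  have "y = 0"
  proof (rule ccontr)
    assume y: "y \<noteq> 0"
    then have dy: "deg y < length X" using div(2) tops_singleton_deg[OF x] by (simp add: lower_def)
    define T where "T = Y + \<tau> * Y'"
    have "y * Y' = \<sigma> * x * Y' + x * \<tau> * Y'"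
      by (simp add: div(1) distrib_right add.commute[of "x * \<tau> * Y'"])
    also have "\<dots> = x * T" by (simp add: eq T_def distrib_left mult.assoc)
    finally have yT: "y * Y' = x * T" .
    have "y * Y' \<noteq> 0" using y Y' by simp
    then have T: "T \<noteq> 0" unfolding yT by auto
    obtain a where a: "a \<in> tops y" using tops_nonempty[OF y] by blast
    obtain v where v: "v \<in> tops Y'" using tops_nonempty[OF Y'] by blast
    have "a @ v \<in> tops (x * T)" unfolding yT[symmetric] using tops_mult_mono[OF y Y' a v] .
    then obtain q where q: "a @ v = X @ q" by (auto simp: tops_mult[OF nz(1) T] x)
    have la: "length a < length X" using tops_length[OF a] dy by simp
    define e where "e = drop (length a) X"
    have "take (length a) (X @ q) = a" using q[symmetric] by simp
    then have Xae: "X = a @ e" using la append_take_drop_id[of "length a" X] by (simp add: e_def)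
    have e: "e \<noteq> []" using la by (simp add: e_def)
    have ve: "v = e @ q" using q unfolding Xae by simp
    have "X @ v \<in> tops (x * Y')" using tops_mult_mono[OF nz(1) Y' _ v] x by simp
    then have "\<rho> @ X @ v \<in> tops (x * Y)"
      unfolding eq[symmetric] using tops_mult_mono[OF nz(2) xY'] \<sigma> by simp
    then obtain y1 where y1: "y1 \<in> tops Y" "\<rho> @ X @ v = X @ y1"
      by (auto simp: tops_mult[OF nz(1) Y] x)
    have "\<rho> @ X @ v = X @ w @ v" using arg_cong[OF w(1), of "\<lambda>l. l @ v"] by simp
    then have "X @ y1 = X @ w @ v" unfolding y1(2) .
    then have y1v: "y1 = w @ e @ q" using ve by simp
    have "suffix e X" unfolding Xae by (simp add: suffix_def)
    then obtain e' where e': "e' \<noteq> []" "length e' \<le> p" "prefix e' e" "suffix e' X"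
      using periodic_suffix_reduce[OF X(1) _ e] by blast
    have "suffix w (X @ w)" "suffix X (X @ w)"
      using w(1) by (auto simp: suffix_def intro: exI[of _ \<rho>] dest: sym)
    then have "suffix w X" using X(2) w(2) suffix_length_suffix by blast
    then have "suffix e' w" using e' w(2) suffix_length_suffix by blast
    moreover have "prefix (w @ e') y1" unfolding y1v using e'(3) by (auto simp: prefix_def)
    ultimately show False using free e' y1(1) by blast
  qed
  then have st: "\<sigma> * x = x * \<tau>" using div by simp
  have "\<sigma> * x \<noteq> 0" using nz by simp
  then have \<tau>: "\<tau> \<noteq> 0" unfolding st by auto
  have "v = w" if "v \<in> tops \<tau>" for v
  proof -
    have "X @ v \<in> tops (x * \<tau>)" using tops_mult_mono[OF nz(1) \<tau> _ that] x by simp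
    then show ?thesis using sx unfolding st by simp
  qed
  then have "tops \<tau> = {w}" using tops_nonempty[OF \<tau>] by blast
  then show ?thesis using st by blast
qed

section \<open>Splitting a pair of coefficients\<close>

lemma tops_left_factor:
  assumes ab: "tops (a * b) = {\<gamma>}" and b: "tops b = {c}"
  shows "\<exists>a0. tops a = {a0} \<and> \<gamma> = a0 @ c"
proof -
  have "a * b \<noteq> 0" using ab tops_singleton_nonzero by blast
  then have a0: "a \<noteq> 0" and b0: "b \<noteq> 0" by auto
  have eq: "w @ c = \<gamma>" if "w \<in> tops a" for w
    using tops_mult_mono[OF a0 b0 that, of c] ab b by simp
  obtain w where w: "w \<in> tops a" using tops_nonempty[OF a0] by blast
  have "v = w" if "v \<in> tops a" for v
    using eq[OF that] eq[OF w] by (metis append_same_eq)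
  then have "tops a = {w}" using w by blast
  then show ?thesis using eq[OF w] by blast
qed

text \<open>
  The possible shapes of two coefficients \<open>r P(s)\<close> and \<open>r Q(s)\<close> that are not equal: the second longer, the
  first longer, or of the same degree.  The functions are polynomials in one variable, and are
  evaluated at \<open>s\<close> to the left of \<open>x\<close> and at \<open>t\<close> to the right of it.
\<close>

definition splittings :: "(('a free_alg \<Rightarrow> 'a free_alg) \<times> ('a free_alg \<Rightarrow> 'a free_alg)) set" where
  "splittings = {(\<lambda>s. 1, \<lambda>s. s), (\<lambda>s. s, \<lambda>s. 1), (\<lambda>s. s + 1, \<lambda>s. s)}"

lemma splitting_cases:
  assumes "(P, Q) \<in> splittings"
  obtains "P = (\<lambda>s. 1)" "Q = (\<lambda>s. s)" | "P = (\<lambda>s. s)" "Q = (\<lambda>s. 1)"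
    | "P = (\<lambda>s. s + 1)" "Q = (\<lambda>s. s)"
  using assms unfolding splittings_def by blast

lemma splitting_commutes:
  assumes PQ: "(P, Q) \<in> splittings" and s: "s * x = x * t"
  shows "P s * x = x * P t \<and> Q s * x = x * Q t"
  using PQ by (cases rule: splitting_cases) (simp_all add: distrib_left distrib_right s)

lemma tops_splitting:
  assumes PQ: "(P, Q) \<in> splittings" and s: "tops s = {w}" "w \<noteq> []"
  shows "(tops (P s) = {[]} \<or> tops (P s) = {w}) \<and> (tops (Q s) = {[]} \<or> tops (Q s) = {w})"
  using PQ by (cases rule: splitting_cases) (simp_all add: s tops_add_one[OF s])

text \<open>
  All three shapes amount to a single relation \<open>s x Y' = x Y\<close> in which \<open>Y\<close> is one of the two
  remainders of the equation, and \<open>Y + t Y'\<close> measures by how much the equation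
  fails after \<open>s\<close> has been moved across \<open>x\<close>.
\<close>

lemma splitting_relation:
  assumes PQ: "((P, Q) :: ('a free_alg \<Rightarrow> 'a free_alg) \<times> ('a free_alg \<Rightarrow> 'a free_alg)) \<in> splittings"
  obtains Y Y' :: "'a free_alg \<Rightarrow> 'a free_alg \<Rightarrow> 'a free_alg"
  where "(\<forall>a b. Y a b = a) \<or> (\<forall>a b. Y a b = b)"
    and "\<And>s x a b. P s * (x * a) = Q s * (x * b) \<Longrightarrow> s * (x * Y' a b) = x * Y a b"
    and "\<And>t a b. P t * a + Q t * b = Y a b + t * Y' a b"
  using PQ
proof (cases rule: splitting_cases)
  case 1
  then show ?thesis by (intro that[of "\<lambda>a b. a" "\<lambda>a b. b"]) simp_all
next
  case 2
  then show ?thesis by (intro that[of "\<lambda>a b. b" "\<lambda>a b. a"]) (simp_all add: add.commute)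
next
  case 3
  show ?thesis
  proof (rule that[of "\<lambda>a b. a" "\<lambda>a b. a + b"])
    fix s x a b :: "'a free_alg"
    assume eq: "P s * (x * a) = Q s * (x * b)"
    have "s * (x * (a + b)) = s * (x * a) + s * (x * b)" by (simp only: distrib_left)
    also have "\<dots> = s * (x * a) + (s + 1) * (x * a)" using eq 3 by simp
    also have "\<dots> = x * a" by (simp add: distrib_right)
    finally show "s * (x * (a + b)) = x * a" .
  next
    fix t a b :: "'a free_alg"
    show "P t * a + Q t * b = a + t * (a + b)"
      using 3 by (simp add: distrib_left distrib_right ac_simps)
  qed simp
qed

context least_period
begin

text \<open>
  If the degrees agree, then so do the top words, and \<open>A + B\<close> takes the role of the shorter
  coefficient.
\<close>

lemma splitting_exists:
  fixes x A B Yu Yv :: "'a free_alg"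
  assumes x: "tops x = {z}" and A: "tops A = {\<alpha>}" and B: "tops B = {\<beta>}" and AB: "A \<noteq> B"
    and Yu: "Yu \<noteq> 0" and Yv: "Yv \<noteq> 0" and eq: "A * (x * Yu) = B * (x * Yv)"
    and len: "length \<alpha> + min p (length \<alpha>) \<le> length z" "length \<beta> + min p (length \<beta>) \<le> length z"
    and free: "\<And>e. e \<noteq> [] \<Longrightarrow> length e \<le> p \<Longrightarrow> prefix e z \<Longrightarrow> \<not> suffix (e @ root) \<alpha>"
      "\<And>e. e \<noteq> [] \<Longrightarrow> length e \<le> p \<Longrightarrow> prefix e z \<Longrightarrow> \<not> suffix (e @ root) \<beta>"
  shows "\<exists>r \<sigma> P Q. (P, Q) \<in> splittings \<and> A = r * P \<sigma> \<and> B = r * Q \<sigma> \<and> tops \<sigma> = {root} \<and> r \<noteq> 0"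
proof -
  note nz = tops_singleton_nonzero[OF A] tops_singleton_nonzero[OF B] tops_singleton_nonzero[OF x]
  \<comment> \<open>The cases follow the order of \<open>splittings\<close>.\<close>
  consider "deg A < deg B" | "deg B < deg A" | "deg A = deg B" by linarith
  then show ?thesis
  proof cases
    case 1
    obtain \<sigma> where "B = A * \<sigma>" "tops \<sigma> = {root}"
      using left_factor_of_longer[OF x B nz(1) 1 Yu eq len(2) free(2)] by blast
    then show ?thesis using nz(1)
      by (intro exI[of _ A] exI[of _ \<sigma>] exI[of _ "\<lambda>s. 1"] exI[of _ "\<lambda>s. s"]) (simp add: splittings_def)
  next
    case 2
    obtain \<sigma> where "A = B * \<sigma>" "tops \<sigma> = {root}"
      using left_factor_of_longer[OF x A nz(2) 2 Yv eq[symmetric] len(1) free(1)] by blast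
    then show ?thesis using nz(2)
      by (intro exI[of _ B] exI[of _ \<sigma>] exI[of _ "\<lambda>s. s"] exI[of _ "\<lambda>s. 1"]) (simp add: splittings_def)
  next
    case 3
    have xY: "x * Yu \<noteq> 0" "x * Yv \<noteq> 0" using nz Yu Yv by simp_all
    obtain a where a: "a \<in> tops (x * Yu)" using tops_nonempty[OF xY(1)] by blast
    have "\<alpha> @ a \<in> tops (B * (x * Yv))"
      unfolding eq[symmetric] using tops_mult_mono[OF nz(1) xY(1) _ a] A by simp
    then obtain b where "\<alpha> @ a = \<beta> @ b" by (auto simp: tops_mult[OF nz(2) xY(2)] B)
    moreover have "length \<alpha> = length \<beta>"
      using 3 tops_singleton_deg[OF A] tops_singleton_deg[OF B] by simp
    ultimately have "tops A = tops B" using A B by simp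
    then have low: "lower (A + B) B"
      using lower_add_of_tops_eq[of A B] 3 nz by (simp add: lower_def)
    define r where "r = A + B"
    have r: "r \<noteq> 0" using AB by (simp add: r_def free_alg_add_eq_0_iff)
    then have dr: "deg r < deg B" using low by (simp add: r_def lower_def)
    have "r * (x * Yu) = B * (x * (Yu + Yv))"
      by (simp add: r_def distrib_left distrib_right eq add.commute)
    then obtain \<sigma> where \<sigma>: "B = r * \<sigma>" "tops \<sigma> = {root}"
      using left_factor_of_longer[OF x B r dr Yu _ len(2) free(2)] by blast
    have "A = B + r" unfolding r_def by (metis add.commute free_alg_add_self_left)
    then have "A = r * (\<sigma> + 1)" unfolding \<sigma>(1) by (simp add: distrib_left)
    then show ?thesis using \<sigma> r
      by (intro exI[of _ r] exI[of _ \<sigma>] exI[of _ "\<lambda>s. s + 1"] exI[of _ "\<lambda>s. s"]) (simp add: splittings_def)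
  qed
qed

end

lemma splitting_conjugates:
  fixes x \<sigma> Yu Yv :: "'a free_alg"
  assumes PQ: "(P, Q) \<in> splittings" and eq: "P \<sigma> * (x * Yu) = Q \<sigma> * (x * Yv)"
    and x: "tops x = {X}" and X: "has_period p X" "p \<le> length X"
    and \<sigma>: "tops \<sigma> = {\<rho>}" and w: "\<rho> @ X = X @ w" "length w = p"
    and Yu: "Yu \<noteq> 0" and Yv: "Yv \<noteq> 0"
    and free: "\<And>e y. e \<noteq> [] \<Longrightarrow> length e \<le> p \<Longrightarrow> suffix e w \<Longrightarrow> y \<in> tops Yu \<union> tops Yv \<Longrightarrow> \<not> prefix (w @ e) y"
  shows "\<exists>\<tau>. \<sigma> * x = x * \<tau> \<and> tops \<tau> = {w}"
proof -
  obtain F F' where F: "(\<forall>a b. F a b = a) \<or> (\<forall>a b. F a b = b)"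
    and rel_F: "\<And>s x a b. P s * (x * a) = Q s * (x * b) \<Longrightarrow> s * (x * F' a b) = x * F a b"
    by (rule splitting_relation[OF PQ]) (rule that)
  define Y Y' where "Y = F Yu Yv" and "Y' = F' Yu Yv"
  have Y: "Y = Yu \<or> Y = Yv" using F unfolding Y_def by blast
  have rel: "\<sigma> * (x * Y') = x * Y" unfolding Y_def Y'_def using rel_F[OF eq] .
  have "Y \<noteq> 0" using Y Yu Yv by auto
  then have "x * Y \<noteq> 0" using tops_singleton_nonzero[OF x] by simp
  then have "Y' \<noteq> 0" unfolding rel[symmetric] by auto
  then show ?thesis
    by (rule right_conjugate_exists[OF x X \<sigma> w rel]) (use free Y in blast)
qed

text \<open>
  The part \<open>x u\<^sub>k x u\<^bsub>k+1\<^esub> \<dots> x u\<^sub>n\<close> of a side of the equation.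
\<close>

definition tail :: "(nat \<Rightarrow> 'a free_alg) \<Rightarrow> 'a free_alg \<Rightarrow> nat \<Rightarrow> nat \<Rightarrow> 'a free_alg" where
  "tail u x n k = prod_list (map (\<lambda>i. x * u i) [k..<Suc n])"

lemma tail_step: "k \<le> n \<Longrightarrow> tail u x n k = x * (u k * tail u x n (Suc k))"
  unfolding tail_def by (subst upt_conv_Cons) (simp_all add: mult.assoc)

lemma tail_end [simp]: "tail u x n (Suc n) = 1"
  by (simp add: tail_def)

lemma side_eq_tail: "side u x n = u 1 * tail u x n (Suc 1)"
  by (simp add: side_def tail_def numeral_2_eq_2)

lemma tail_nonzero:
  assumes "x \<noteq> 0" "\<And>i. k \<le> i \<Longrightarrow> i \<le> n \<Longrightarrow> u i \<noteq> 0" "k \<le> Suc n"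
  shows "tail u x n k \<noteq> 0"
  using assms(3,2)
proof (induction k rule: inc_induct)
  case base
  then show ?case by (metis tail_end tops_one tops_zero insert_not_empty)
next
  case (step k)
  have "tail u x n (Suc k) \<noteq> 0" using step by simp
  then show ?case using step assms(1) by (simp add: tail_step)
qed

lemma
  fixes u v :: "nat \<Rightarrow> 'a free_alg"
  assumes i: "1 \<le> i" "i \<le> n" and same: "\<And>j. 1 \<le> j \<Longrightarrow> j < i \<Longrightarrow> u j = v j"
  shows side_eqI: "u i * tail u x n (Suc i) = v i * tail v x n (Suc i) \<Longrightarrow> side u x n = side v x n"
    and side_eqD: "x \<noteq> 0 \<Longrightarrow> (\<And>j. 1 \<le> j \<Longrightarrow> j < i \<Longrightarrow> u j \<noteq> 0) \<Longrightarrow> side u x n = side v x n \<Longrightarrow>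
       u i * tail u x n (Suc i) = v i * tail v x n (Suc i)"
proof -
  have "(u i * tail u x n (Suc i) = v i * tail v x n (Suc i) \<longrightarrow> side u x n = side v x n) \<and>
    (x \<noteq> 0 \<and> (\<forall>j. 1 \<le> j \<and> j < i \<longrightarrow> u j \<noteq> 0) \<longrightarrow> side u x n = side v x n \<longrightarrow>
       u i * tail u x n (Suc i) = v i * tail v x n (Suc i))"
    using i same
  proof (induction i rule: dec_induct)
    case base
    show ?case unfolding side_eq_tail by simp
  next
    case (step m)
    have uv: "u m = v m" using step by simp
    have "tail u x n (Suc m) = x * (u (Suc m) * tail u x n (Suc (Suc m)))"
      "tail v x n (Suc m) = x * (v (Suc m) * tail v x n (Suc (Suc m)))"
      using step.prems by (simp_all add: tail_step)
    then have "u m * tail u x n (Suc m) = v m * tail v x n (Suc m) \<longleftrightarrow>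
        u m = 0 \<or> x = 0 \<or> u (Suc m) * tail u x n (Suc (Suc m)) = v (Suc m) * tail v x n (Suc (Suc m))"
      using uv by simp
    moreover have "m \<le> n" "\<And>j. 1 \<le> j \<Longrightarrow> j < m \<Longrightarrow> u j = v j" using step.prems by auto
    ultimately show ?case using step.IH step.hyps by (metis less_Suc_eq)
  qed
  then show "u i * tail u x n (Suc i) = v i * tail v x n (Suc i) \<Longrightarrow> side u x n = side v x n"
    and "x \<noteq> 0 \<Longrightarrow> (\<And>j. 1 \<le> j \<Longrightarrow> j < i \<Longrightarrow> u j \<noteq> 0) \<Longrightarrow> side u x n = side v x n \<Longrightarrow>
       u i * tail u x n (Suc i) = v i * tail v x n (Suc i)"
    by blast+
qed

section \<open>Coefficients between consecutive appearances of the unknown\<close>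

lemma has_period_of_shifted_copy:
  assumes "b \<noteq> []" "b @ X @ q = X @ q'"
  shows "has_period (length b) X"
  unfolding has_period_def
proof (intro conjI allI impI)
  show "0 < length b" using assms(1) by simp
  fix i assume i: "i + length b < length X"
  have "(b @ X @ q) ! (i + length b) = X ! i" using i by (simp add: nth_append)
  moreover have "(X @ q') ! (i + length b) = X ! (i + length b)" using i by (simp add: nth_append)
  ultimately show "X ! i = X ! (i + length b)" using assms(2) by simp
qed

context least_period
begin

lemma nth_eq_root: "i < length z \<Longrightarrow> z ! i = root ! (i mod p)"
  using has_period_nth_mod[OF period] period_pos by simp

text \<open>
  From \<open>s x Y' = x Y\<close>, removing \<open>\<rho>\<close> from the front of a top word of \<open>x\<close> leaves the beginning of another top word of
  \<open>x\<close>.  So all of them spell out the powers of \<open>\<rho>\<close>, and since they have equal length there is only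
  one.  This replaces, for an arbitrary long solution, the assumption that the top part is a
  monomial.
\<close>

lemma long_solution_top:
  fixes x s Y Y' :: "'a free_alg"
  assumes s: "tops s = {root}" and eq: "s * (x * Y') = x * Y" and Y: "Y \<noteq> 0"
    and pre: "\<And>y. y \<in> tops Y \<Longrightarrow> prefix coroot y" and x: "x \<noteq> 0" "p \<le> deg x"
  shows "\<exists>X. tops x = {X} \<and> (\<forall>j < length X. X ! j = root ! (j mod p)) \<and> root @ X = X @ coroot"
proof -
  have s0: "s \<noteq> 0" using tops_singleton_nonzero[OF s] .
  have xY: "x * Y \<noteq> 0" using x Y by simp
  then have "s * (x * Y') \<noteq> 0" unfolding eq .
  then have Y': "Y' \<noteq> 0" and xY': "x * Y' \<noteq> 0" by auto
  obtain y where y: "y \<in> tops Y" using tops_nonempty[OF Y] by blast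
  have step: "\<exists>a'\<in>tops x. \<exists>y'. a @ y = root @ a' @ y'" if "a \<in> tops x" for a
  proof -
    have "a @ y \<in> tops (s * (x * Y'))" unfolding eq using tops_mult_mono[OF x(1) Y that y] .
    then obtain a' y' where "a' \<in> tops x" "a @ y = root @ a' @ y'"
      by (auto simp: tops_mult[OF s0 xY'] tops_mult[OF x(1) Y'] s)
    then show ?thesis by blast
  qed
  \<comment> \<open>The letter at position \<open>j\<close> of one top word is the letter at position \<open>j - p\<close> of another.\<close>
  have nth: "\<forall>a\<in>tops x. j < deg x \<longrightarrow> a ! j = root ! (j mod p)" for j
  proof (induction j rule: less_induct)
    case (less j)
    show ?case
    proof (intro ballI impI)
      fix a assume a: "a \<in> tops x" and j: "j < deg x"
      obtain a' y' where a': "a' \<in> tops x" and eq': "a @ y = root @ a' @ y'" using step[OF a] by blast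
      have "a ! j = (root @ a' @ y') ! j"
        unfolding eq'[symmetric] using tops_length[OF a] j by (simp add: nth_append)
      also have "\<dots> = root ! (j mod p)"
      proof (cases "j < p")
        case True
        then show ?thesis using period_le by (simp add: nth_append)
      next
        case False
        moreover have "j - p < deg x" using j by simp
        ultimately have "(root @ a' @ y') ! j = a' ! (j - p)"
          using tops_length[OF a'] j period_le period_pos by (simp add: nth_append)
        also have "\<dots> = root ! ((j - p) mod p)"
          using less.IH[of "j - p"] False j a' period_pos by simp
        finally show ?thesis using False by (simp add: le_mod_geq)
      qed
      finally show "a ! j = root ! (j mod p)" .
    qed
  qed
  obtain X where X: "X \<in> tops x" using tops_nonempty[OF x(1)] by blast
  have lX: "length X = deg x" using tops_length[OF X] .
  have "a = X" if "a \<in> tops x" for a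
    using nth that X tops_length[OF that] lX by (intro nth_equalityI) simp_all
  then have tx: "tops x = {X}" using X by blast
  obtain q where q: "y = coroot @ q" using pre[OF y] by (auto simp: prefix_def)
  obtain y' where "X @ y = root @ X @ y'" using step[OF X] tx by auto
  then have "take (length X + p) (X @ coroot @ q) = take (length X + p) (root @ X @ y')"
    using q by simp
  then have "X @ coroot = root @ X" using length_root length_coroot by simp
  then show ?thesis using tx nth X lX by metis
qed

end

text \<open>
  One side of the equation.  The two sides are two instances of this locale, so facts about
  the words around a coefficient are proved once.
\<close>

locale coefficient_words = least_period z p for z :: "'a list" and p :: nat +
  fixes u :: "nat \<Rightarrow> 'a free_alg" and U :: "nat \<Rightarrow> 'a list" and n :: nat
  assumes tops_u: "1 \<le> i \<Longrightarrow> i \<le> n \<Longrightarrow> tops (u i) = {U i}"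
    and squarefree: "1 \<le> i \<Longrightarrow> i \<le> n \<Longrightarrow> no_periodicity (U i)"
    and junctions: "2 \<le> k \<Longrightarrow> k < n \<Longrightarrow> junction p z (U k)"
    and two_periods: "2 * p \<le> length z"
begin

lemma u_nonzero: "1 \<le> i \<Longrightarrow> i \<le> n \<Longrightarrow> u i \<noteq> 0"
  by (rule tops_singleton_nonzero[OF tops_u])

lemma rest_nonzero:
  assumes "x \<noteq> 0" "1 \<le> k" "k \<le> n"
  shows "u k * tail u x n (Suc k) \<noteq> 0"
proof -
  have "tail u x n (Suc k) \<noteq> 0"
    by (rule tail_nonzero) (use assms u_nonzero in auto)
  then show ?thesis using u_nonzero[of k] assms by simp
qed

lemma tops_rest:
  assumes x: "tops x = {X}" and k: "1 \<le> k" "k \<le> n" and y: "y \<in> tops (u k * tail u x n (Suc k))"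
  shows "k = n \<and> y = U k \<or> k < n \<and> (\<exists>q. y = U k @ X @ q)"
proof (cases "k = n")
  case True
  then show ?thesis using y tops_u[of n] k by simp
next
  case False
  then have k': "Suc k \<le> n" using k by simp
  note x0 = tops_singleton_nonzero[OF x]
  have rest: "u (Suc k) * tail u x n (Suc (Suc k)) \<noteq> 0"
    using rest_nonzero[OF x0 _ k'] by simp
  have "tail u x n (Suc k) = x * (u (Suc k) * tail u x n (Suc (Suc k)))"
    using tail_step[OF k'] .
  then obtain b where b: "b \<in> tops (x * (u (Suc k) * tail u x n (Suc (Suc k))))" "y = U k @ b"
    using y rest x0 u_nonzero[OF k] tops_u[OF k] by (auto simp: tops_mult)
  then obtain q where "b = X @ q" using x by (auto simp: tops_mult[OF x0 rest])
  then show ?thesis using b False k by simp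
qed

text \<open>
  Only the first \<open>2 p\<close> letters of the unknown matter here, so that the statement, which comes
  from the given solution, holds for every long solution.
\<close>

lemma no_repeat_after_coroot:
  assumes x: "tops x = {X}" "take (2 * p) X = take (2 * p) z" and k: "2 \<le> k" "k \<le> n"
    and e: "e \<noteq> []" "length e \<le> p" "suffix e coroot" and y: "y \<in> tops (u k * tail u x n (Suc k))"
  shows "\<not> prefix (coroot @ e) y"
proof
  assume pre: "prefix (coroot @ e) y"
  consider "k = n" "y = U k" | q where "k < n" "y = U k @ X @ q"
    using tops_rest[OF x(1) _ k(2) y] k by auto
  then show False
  proof cases
    case 1
    then obtain g where g: "U k = (coroot @ e) @ g" using pre by (auto simp: prefix_def)
    obtain w' where "coroot = w' @ e" using e(3) by (auto simp: suffix_def)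
    then have "U k = w' @ e @ e @ g" using g by simp
    then show False using no_periodicityD[OF squarefree[of k]] k e by fastforce
  next
    case 2
    have "length (coroot @ e) \<le> length (U k @ take (2 * p) z)"
      using e(2) length_coroot two_periods by simp
    moreover have "prefix (U k @ take (2 * p) z) y"
      unfolding 2 x(2)[symmetric] by (metis append.assoc append_take_drop_id prefixI same_prefix_prefix)
    ultimately have "prefix (coroot @ e) (U k @ take (2 * p) z)"
      using pre prefix_length_prefix by blast
    then have "prefix (coroot @ e) (U k @ z)"
      by (meson same_prefix_prefix take_is_prefix prefix_order.trans)
    then show False
      using junction_right[OF junctions[OF k(1)] squarefree[of k] period two_periods refl e(1,2,3)] 2 k
      by simp
  qed
qed

text \<open>
  The coefficient may have received a factor with top word \<open>w\<close> from the left; this is still a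
  suffix of \<open>z U\<^sub>k\<close>, where \<open>junction_left\<close> applies.
\<close>

lemma no_repeat_before_root:
  assumes k: "2 \<le> k" "k < n" and a: "a = U k \<or> a = coroot @ U k"
    and e: "e \<noteq> []" "length e \<le> p" "prefix e z"
  shows "\<not> suffix (e @ root) a"
proof
  assume "suffix (e @ root) a"
  moreover have "suffix a (z @ U k)"
    using a by (auto simp: suffix_def) (metis append_take_drop_id)
  ultimately have "suffix (e @ root) (z @ U k)" using suffix_order.trans by blast
  then show False
    using junction_left[OF junctions[OF k] squarefree[of k] period two_periods e] k by simp
qed

text \<open>
  Otherwise \<open>U\<^sub>k\<close> would be a prefix of \<open>w\<close>, and the left run would cover it.
\<close>

lemma coroot_prefix:
  assumes x: "tops x = {z}" and k: "2 \<le> k" "k \<le> n"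
    and y: "y \<in> tops (u k * tail u x n (Suc k))" "prefix coroot y"
  shows "prefix coroot (U k)"
proof -
  consider "y = U k" | q where "k < n" "y = U k @ z @ q"
    using tops_rest[OF x _ k(2) y(1)] k by auto
  then show ?thesis
  proof cases
    case 1
    then show ?thesis using y(2) by simp
  next
    case 2
    have "prefix coroot (U k) \<or> prefix (U k) coroot"
      using y(2) prefix_same_cases[of coroot y "U k"] 2 by simp
    moreover have "\<not> prefix (U k) coroot"
    proof
      assume "prefix (U k) coroot"
      then obtain g where g: "coroot = U k @ g" by (auto simp: prefix_def)
      have "root @ root @ z = (root @ z) @ coroot" using root_shift by simp
      then have "has_period p (root @ z)"
        using has_period_conjugate[of root "root @ z" coroot] length_root period_pos period_le by auto
      then have "has_period p ((z @ U k) @ g)" using root_shift g by simp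
      then have "has_period p (z @ U k)" by (rule has_period_prefix)
      then show False
        using junction_not_periodic_left[OF junctions[OF k(1) 2(1)] period two_periods] by blast
    qed
    ultimately show ?thesis by blast
  qed
qed

text \<open>
  In the application \<open>d\<close> is the difference of two candidates for the conjugate \<open>t\<close>.  Write \<open>U\<^sub>k = w g\<close>.  Top words in \<open>d Y' = \<psi> x Z\<close> place a
  copy of \<open>X\<close> after \<open>d\<^sub>0 g\<close> and another one after \<open>\<psi>\<^sub>0\<close>, where \<open>|\<psi>\<^sub>0|\<close> and \<open>|g|\<close> agree modulo \<open>p\<close>.  Since
  shifts of \<open>X\<close> against itself are multiples of \<open>p\<close>, and \<open>|d\<^sub>0| < p\<close>, the word \<open>d\<^sub>0\<close> is empty.  Then the
  top words of \<open>Y'\<close> begin with \<open>w\<close>, and those of \<open>t Y'\<close> with \<open>w w\<close>, which is excluded.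
\<close>

lemma no_constant_shift:
  assumes k: "2 \<le> k" "k < n" and x: "tops x = {X}" "take (2 * p) X = take (2 * p) z"
    and X: "has_period p X" "\<And>d. d < p \<Longrightarrow> \<not> has_period d X" "length (U k) + 3 * p \<le> length X"
    and pre: "prefix coroot (U k)" and \<psi>: "tops \<psi> = {\<psi>0}"
    and \<gamma>: "\<gamma> = U k \<or> \<gamma> = coroot @ U k" "\<gamma> = \<psi>0 \<or> \<gamma> = \<psi>0 @ root"
    and Y: "u k * tail u x n (Suc k) = t * Y'" "tops t = {coroot}"
    and eq: "d * Y' = \<psi> * (x * Z)" and d: "d \<noteq> 0" "deg d < p"
  shows False
proof -
  note nz = tops_singleton_nonzero[OF x(1)] tops_singleton_nonzero[OF \<psi>] tops_singleton_nonzero[OF Y(2)]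
  have "u k * tail u x n (Suc k) \<noteq> 0" using rest_nonzero[OF nz(1)] k by simp
  then have Y': "Y' \<noteq> 0" unfolding Y(1) by auto
  have "d * Y' \<noteq> 0" using d Y' by simp
  then have xZ: "x * Z \<noteq> 0" and Z: "Z \<noteq> 0" unfolding eq by auto
  obtain y where y: "y \<in> tops Y'" using tops_nonempty[OF Y'] by blast
  have cy: "coroot @ y \<in> tops (u k * tail u x n (Suc k))"
    unfolding Y(1) using tops_mult_mono[OF nz(3) Y' _ y] Y(2) by simp
  then obtain q where q: "coroot @ y = U k @ X @ q" using tops_rest[OF x(1) _ _ cy] k by auto
  obtain g where g: "U k = coroot @ g" using pre by (auto simp: prefix_def)
  have yg: "y = g @ X @ q" using q unfolding g by simp
  obtain d0 where d0: "d0 \<in> tops d" using tops_nonempty[OF d(1)] by blast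
  have "d0 @ y \<in> tops (\<psi> * (x * Z))"
    unfolding eq[symmetric] using tops_mult_mono[OF d(1) Y' d0 y] .
  then obtain q' where "d0 @ y = \<psi>0 @ X @ q'"
    by (auto simp: tops_mult[OF nz(2) xZ] tops_mult[OF nz(1) Z] x \<psi>)
  then have al: "(d0 @ g) @ X @ q = \<psi>0 @ X @ q'" using yg by simp
  have ld: "length d0 < p" using tops_length[OF d0] d by simp
  have "length \<psi>0 = length g \<or> length \<psi>0 = length g + p \<or> length \<psi>0 = length g + 2 * p"
  proof -
    have "length \<gamma> = length g + p \<or> length \<gamma> = length g + 2 * p"
      using \<gamma>(1) length_coroot by (auto simp: g)
    moreover have "length \<gamma> = length \<psi>0 \<or> length \<gamma> = length \<psi>0 + p"
      using \<gamma>(2) length_root by auto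
    ultimately show ?thesis by linarith
  qed
  then obtain m where m: "length \<psi>0 = length g + m * p" "m \<le> 2"
    by (metis add.right_neutral mult_0 mult_1 le0 one_le_numeral order.refl)
  have "p dvd length d0"
  proof (cases "length (d0 @ g) \<le> length \<psi>0")
    case True
    define b where "b = drop (length (d0 @ g)) \<psi>0"
    have "take (length (d0 @ g)) (\<psi>0 @ X @ q') = d0 @ g" unfolding al[symmetric] by simp
    then have "take (length (d0 @ g)) \<psi>0 = d0 @ g" using True by simp
    then have \<psi>b: "\<psi>0 = (d0 @ g) @ b" unfolding b_def by (metis append_take_drop_id)
    then have bX: "b @ X @ q' = X @ q" using al by simp
    have lb: "length b + length d0 = m * p" using m(1) arg_cong[OF \<psi>b, of length] by simp
    have "p dvd length b"
    proof (cases "b = []")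
      case False
      have "m * p \<le> 2 * p" using m(2) by simp
      then have "length b + p \<le> length X" using lb X(3) by linarith
      then show ?thesis
        using minimal_period_dvd[OF X(1,2) has_period_of_shifted_copy[OF False bX]] by blast
    qed simp
    then show ?thesis using lb by (metis dvd_add_right_iff dvd_triv_right)
  next
    case False
    define b where "b = drop (length \<psi>0) (d0 @ g)"
    have "take (length \<psi>0) ((d0 @ g) @ X @ q) = \<psi>0" unfolding al by simp
    then have "take (length \<psi>0) (d0 @ g) = \<psi>0" using False by (simp del: append_assoc)
    then have \<psi>b: "d0 @ g = \<psi>0 @ b" unfolding b_def by (metis append_take_drop_id)
    then have bX: "b @ X @ q = X @ q'" using al by simp
    have "length d0 = m * p + length b" using m(1) arg_cong[OF \<psi>b, of length] by simp
    then have "length b < p" using ld by simp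
    moreover have "b \<noteq> []" using False unfolding b_def drop_eq_Nil by simp
    ultimately show ?thesis using X(2) has_period_of_shifted_copy[OF _ bX] by blast
  qed
  then have "d0 = []" using ld by (metis dvd_imp_le length_0_conv not_less neq0_conv)
  then have y\<psi>: "y = \<psi>0 @ X @ q'" using al yg by simp
  have "take p (take (2 * p) X) = root" unfolding x(2) by simp
  then have "take p X = root" by (simp add: min_def split: if_splits)
  then have "prefix root X" by (metis take_is_prefix)
  then have "prefix \<gamma> y" using \<gamma>(2) unfolding y\<psi> by (auto simp: prefix_def)
  moreover have "prefix coroot \<gamma>" using \<gamma>(1) pre by auto
  ultimately have "prefix (coroot @ coroot) (coroot @ y)"
    using prefix_order.trans by auto
  moreover have "coroot \<noteq> []" using length_coroot period_pos by (metis list.size(3) less_irrefl)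
  ultimately show False
    using no_repeat_after_coroot[OF x k(1) _ _ _ _ cy, of coroot] k length_coroot by simp
qed

end

section \<open>Propagation along the equation\<close>

text \<open>
  Here \<open>D\<close> stands for the common sum of the degrees on either side.
\<close>

locale equation = least_period z p +
    left: coefficient_words z p u U n + right: coefficient_words z p v V n
    for z :: "'a list" and p u U v V n +
  fixes x :: "'a free_alg" and D :: nat
  assumes tops_x: "tops x = {z}"
    and U_le: "1 \<le> i \<Longrightarrow> i \<le> n \<Longrightarrow> length (U i) \<le> D"
    and V_le: "1 \<le> i \<Longrightarrow> i \<le> n \<Longrightarrow> length (V i) \<le> D"
    and p_le: "p \<le> D"
    and long: "3 * D \<le> length z"
begin

lemma coroot_nonempty: "coroot \<noteq> []"
  using length_coroot period_pos by (metis list.size(3) less_irrefl)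

text \<open>
  One step along the equation: the factor \<open>\<sigma>\<close> passes through the unknown \<open>y\<close> and acts as \<open>\<tau>\<close> on the
  next coefficients.  It is stated for a general \<open>y\<close>, since it is needed for \<open>x\<close> and for long
  solutions.
\<close>

lemma advance:
  assumes y: "tops y = {X}" and X: "has_period p X" "p \<le> length X" "root @ X = X @ coroot"
      "take (2 * p) X = take (2 * p) z"
    and k: "1 \<le> k" "k < n" and PQ: "(P, Q) \<in> splittings" and \<sigma>: "tops \<sigma> = {root}"
    and eq: "P \<sigma> * tail u y n (Suc k) = Q \<sigma> * tail v y n (Suc k)"
  shows "\<exists>\<tau>. \<sigma> * y = y * \<tau> \<and> tops \<tau> = {coroot} \<and>
    P \<tau> * (u (Suc k) * tail u y n (Suc (Suc k))) = Q \<tau> * (v (Suc k) * tail v y n (Suc (Suc k)))"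
proof -
  note y0 = tops_singleton_nonzero[OF y]
  define Yu where "Yu = u (Suc k) * tail u y n (Suc (Suc k))"
  define Yv where "Yv = v (Suc k) * tail v y n (Suc (Suc k))"
  have k': "Suc k \<le> n" "2 \<le> Suc k" "1 \<le> Suc k" using k by simp_all
  have Y0: "Yu \<noteq> 0" "Yv \<noteq> 0" unfolding Yu_def Yv_def
    by (rule left.rest_nonzero[OF y0 k'(3,1)], rule right.rest_nonzero[OF y0 k'(3,1)])
  have eq': "P \<sigma> * (y * Yu) = Q \<sigma> * (y * Yv)"
    using eq unfolding Yu_def Yv_def tail_step[OF k'(1), symmetric] .
  have free: "\<not> prefix (coroot @ e) w"
    if "e \<noteq> []" "length e \<le> p" "suffix e coroot" "w \<in> tops Yu \<union> tops Yv" for e w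
    using that(4) left.no_repeat_after_coroot[OF y X(4) k'(2,1) that(1,2,3), of w]
      right.no_repeat_after_coroot[OF y X(4) k'(2,1) that(1,2,3), of w]
    unfolding Yu_def Yv_def by blast
  obtain \<tau> where \<tau>: "\<sigma> * y = y * \<tau>" "tops \<tau> = {coroot}"
    using splitting_conjugates[OF PQ eq' y X(1,2) \<sigma> X(3) length_coroot Y0 free] by blast
  have "P \<sigma> * y = y * P \<tau>" "Q \<sigma> * y = y * Q \<tau>"
    using splitting_commutes[OF PQ \<tau>(1)] by simp_all
  then have "y * (P \<tau> * Yu) = y * (Q \<tau> * Yv)" using eq' by (simp add: mult.assoc[symmetric])
  then have "P \<tau> * Yu = Q \<tau> * Yv" using y0 by simp
  then show ?thesis using \<tau> unfolding Yu_def Yv_def by blast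
qed

lemmas advance_x = advance[OF tops_x period period_le root_shift refl]

lemma next_coefficient_tops:
  assumes PQ: "(P, Q) \<in> insert (\<lambda>_. 1, \<lambda>_. 1) splittings" and \<tau>: "tops \<tau> = {coroot}"
    and k: "1 \<le> k" "k \<le> n"
  shows "\<exists>\<alpha>. tops (P \<tau> * u k) = {\<alpha>} \<and> (\<alpha> = U k \<or> \<alpha> = coroot @ U k)"
    and "\<exists>\<beta>. tops (Q \<tau> * v k) = {\<beta>} \<and> (\<beta> = V k \<or> \<beta> = coroot @ V k)"
proof -
  have "(tops (P \<tau>) = {[]} \<or> tops (P \<tau>) = {coroot}) \<and> (tops (Q \<tau>) = {[]} \<or> tops (Q \<tau>) = {coroot})"
    using PQ tops_splitting[OF _ \<tau> coroot_nonempty, of P Q] by auto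
  then show "\<exists>\<alpha>. tops (P \<tau> * u k) = {\<alpha>} \<and> (\<alpha> = U k \<or> \<alpha> = coroot @ U k)"
    and "\<exists>\<beta>. tops (Q \<tau> * v k) = {\<beta>} \<and> (\<beta> = V k \<or> \<beta> = coroot @ V k)"
    using tops_mult_singleton[OF _ left.tops_u[OF k]] tops_mult_singleton[OF _ right.tops_u[OF k]]
    by fastforce+
qed

lemma next_splitting:
  assumes PQ: "(P, Q) \<in> insert (\<lambda>_. 1, \<lambda>_. 1) splittings" and \<tau>: "tops \<tau> = {coroot}"
    and k: "2 \<le> k" "k < n"
    and eq: "P \<tau> * u k * tail u x n (Suc k) = Q \<tau> * v k * tail v x n (Suc k)"
    and neq: "P \<tau> * u k \<noteq> Q \<tau> * v k"
  shows "\<exists>r \<sigma> P' Q'. (P', Q') \<in> splittings \<and> P \<tau> * u k = r * P' \<sigma> \<and> Q \<tau> * v k = r * Q' \<sigma> \<and>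
    tops \<sigma> = {root} \<and> r \<noteq> 0"
proof -
  note x0 = tops_singleton_nonzero[OF tops_x]
  have k': "Suc k \<le> n" "1 \<le> Suc k" "1 \<le> k" "k \<le> n" using k by simp_all
  obtain \<alpha> where \<alpha>: "tops (P \<tau> * u k) = {\<alpha>}" "\<alpha> = U k \<or> \<alpha> = coroot @ U k"
    using next_coefficient_tops(1)[OF PQ \<tau> k'(3,4)] by blast
  obtain \<beta> where \<beta>: "tops (Q \<tau> * v k) = {\<beta>}" "\<beta> = V k \<or> \<beta> = coroot @ V k"
    using next_coefficient_tops(2)[OF PQ \<tau> k'(3,4)] by blast
  have "length \<alpha> \<le> p + D" "length \<beta> \<le> p + D"
    using \<alpha>(2) \<beta>(2) length_coroot U_le[OF k'(3,4)] V_le[OF k'(3,4)] by auto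
  then have len: "length \<alpha> + min p (length \<alpha>) \<le> length z" "length \<beta> + min p (length \<beta>) \<le> length z"
    using p_le long by linarith+
  have eq': "(P \<tau> * u k) * (x * (u (Suc k) * tail u x n (Suc (Suc k)))) =
      (Q \<tau> * v k) * (x * (v (Suc k) * tail v x n (Suc (Suc k))))"
    using eq unfolding tail_step[OF k'(1)] .
  show ?thesis
    by (rule splitting_exists[OF tops_x \<alpha>(1) \<beta>(1) neq left.rest_nonzero[OF x0 k'(2,1)]
        right.rest_nonzero[OF x0 k'(2,1)] eq' len left.no_repeat_before_root[OF k \<alpha>(2)]
        right.no_repeat_before_root[OF k \<beta>(2)]])
qed

text \<open>
  Induction along the equation, from its end to the given index.  For \<open>x\<close> the current coefficients either agree or split, and
  the factorization found for \<open>x\<close> mentions only coefficients, so it can be reused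
  for \<open>x'\<close>.  The conjugator of a later step is \<open>s\<close> or \<open>s + 1\<close>, which \<open>x'\<close> intertwines as well.  For this
  reason \<open>\<tau>\<close> ranges over \<open>t\<close> and \<open>t + 1\<close>, and the pair of constant functions accounts for
  coefficients to which nothing has been carried over.
\<close>

lemma intertwined_solution:
  assumes s: "tops s = {root}" "s * x = x * t" and t: "tops t = {coroot}"
    and x': "s * x' = x' * t"
    and k: "2 \<le> k" "k \<le> n" and PQ: "(P, Q) \<in> insert (\<lambda>_. 1, \<lambda>_. 1) splittings"
    and \<tau>: "\<tau> = t \<or> \<tau> = t + 1"
    and eq: "P \<tau> * u k * tail u x n (Suc k) = Q \<tau> * v k * tail v x n (Suc k)"
  shows "P \<tau> * u k * tail u x' n (Suc k) = Q \<tau> * v k * tail v x' n (Suc k)"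
  using k(2,1) PQ \<tau> eq
proof (induction k arbitrary: P Q \<tau> rule: inc_induct)
  case base
  then show ?case by simp
next
  case (step k)
  note x0 = tops_singleton_nonzero[OF tops_x]
  have k': "Suc k \<le> n" "2 \<le> Suc k" "2 \<le> k" "k < n" "1 \<le> k" using step by simp_all
  have tops\<tau>: "tops \<tau> = {coroot}"
    using step.prems(3) t tops_add_one[OF t coroot_nonempty] by auto
  define Yu where "Yu = (\<lambda>y. u (Suc k) * tail u y n (Suc (Suc k)))"
  define Yv where "Yv = (\<lambda>y. v (Suc k) * tail v y n (Suc (Suc k)))"
  have tails: "tail u y n (Suc k) = y * Yu y" "tail v y n (Suc k) = y * Yv y" for y
    unfolding Yu_def Yv_def by (rule tail_step[OF k'(1)])+
  show ?case
  proof (cases "P \<tau> * u k = Q \<tau> * v k")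
    case True
    have "Q \<tau> * v k \<noteq> 0"
      using next_coefficient_tops(2)[OF step.prems(2) tops\<tau> k'(5)] k'(4) tops_singleton_nonzero by force
    then have "Yu x = Yv x" using step.prems(4) True x0 unfolding tails by simp
    then have "Yu x' = Yv x'"
      using step.IH[of "\<lambda>_. 1" "\<lambda>_. 1" \<tau>] k'(2) step.prems(3) unfolding Yu_def Yv_def by simp
    then show ?thesis using True unfolding tails by simp
  next
    case False
    obtain r \<sigma> P' Q' where PQ': "(P', Q') \<in> splittings" and
      eqs: "P \<tau> * u k = r * P' \<sigma>" "Q \<tau> * v k = r * Q' \<sigma>" and \<sigma>: "tops \<sigma> = {root}" and r: "r \<noteq> 0"
      using next_splitting[OF step.prems(2) tops\<tau> k'(3,4) step.prems(4) False] by blast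
    have "r * (P' \<sigma> * tail u x n (Suc k)) = r * (Q' \<sigma> * tail v x n (Suc k))"
      using step.prems(4) unfolding eqs by (simp only: mult.assoc)
    then have "P' \<sigma> * tail u x n (Suc k) = Q' \<sigma> * tail v x n (Suc k)" using r by simp
    then obtain \<tau>' where \<tau>': "\<sigma> * x = x * \<tau>'" "P' \<tau>' * Yu x = Q' \<tau>' * Yv x"
      using advance_x[OF k'(5,4) PQ' \<sigma>] unfolding Yu_def Yv_def by blast
    have cases: "\<sigma> = s \<and> \<tau>' = t \<or> \<sigma> = s + 1 \<and> \<tau>' = t + 1"
      using conjugators_differ_by_constant[OF tops_x s \<sigma> \<tau>'(1)] .
    then have "\<sigma> * x' = x' * \<tau>'" using x' by (auto simp: distrib_left distrib_right)
    note comm = splitting_commutes[OF PQ' this]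
    have "P' \<tau>' * Yu x' = Q' \<tau>' * Yv x'"
      using step.IH[of P' Q' \<tau>'] k'(2) PQ' cases \<tau>'(2) unfolding Yu_def Yv_def
      by (auto simp: mult.assoc)
    then have "x' * P' \<tau>' * Yu x' = x' * Q' \<tau>' * Yv x'" by (simp only: mult.assoc)
    then have "P' \<sigma> * (x' * Yu x') = Q' \<sigma> * (x' * Yv x')" using comm by (metis mult.assoc)
    then show ?thesis unfolding eqs tails by (simp only: mult.assoc)
  qed
qed

end

section \<open>Long solutions\<close>

context least_period
begin

lemma rest_starts_with_coroot:
  fixes x s Y Y' :: "'a free_alg"
  assumes x: "tops x = {z}" and s: "tops s = {root}" and eq: "s * (x * Y') = x * Y" and y: "y \<in> tops Y"
  shows "prefix coroot y"
proof -
  note x0 = tops_singleton_nonzero[OF x] and s0 = tops_singleton_nonzero[OF s]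
  have Y: "Y \<noteq> 0" using y by (rule tops_nonzero)
  then have "x * Y \<noteq> 0" using x0 by simp
  then have "s * (x * Y') \<noteq> 0" unfolding eq .
  then have Y': "Y' \<noteq> 0" and xY': "x * Y' \<noteq> 0" by auto
  have "z @ y \<in> tops (s * (x * Y'))" unfolding eq using tops_mult_mono[OF x0 Y _ y] x by simp
  then obtain y' where "z @ y = root @ z @ y'" by (auto simp: tops_mult[OF s0 xY'] tops_mult[OF x0 Y'] s x)
  also have "root @ z @ y' = (root @ z) @ y'" by simp
  also have "\<dots> = z @ coroot @ y'" unfolding root_shift by simp
  finally show ?thesis by simp
qed

text \<open>
  A long power of \<open>\<rho>\<close> determines the period structure of \<open>z\<close>, so it inherits \<open>p\<close> as its least period.
\<close>

lemma root_power_periods: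
  assumes X: "\<And>j. j < length X \<Longrightarrow> X ! j = root ! (j mod p)" and len: "2 * p \<le> length X" "2 * p \<le> length z"
  shows "has_period p X" and "take (2 * p) X = take (2 * p) z" and "d < p \<Longrightarrow> \<not> has_period d X"
proof -
  show "has_period p X" unfolding has_period_def
  proof (intro conjI allI impI)
    show "0 < p" by (rule period_pos)
    fix i assume "i + p < length X"
    then show "X ! i = X ! (i + p)" using X[of i] X[of "i + p"] by simp
  qed
  show "take (2 * p) X = take (2 * p) z"
  proof (rule nth_equalityI)
    show "length (take (2 * p) X) = length (take (2 * p) z)" using len by simp
    fix i assume "i < length (take (2 * p) X)"
    then show "take (2 * p) X ! i = take (2 * p) z ! i"
      using X[of i] nth_eq_root[of i] len by simp
  qed
  show "\<not> has_period d X" if d: "d < p"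
  proof
    assume per: "has_period d X"
    have "has_period d z" unfolding has_period_def
    proof (intro conjI allI impI)
      show "0 < d" using per by (rule has_period_pos)
      fix i assume i: "i + d < length z"
      have m: "i mod p < p" using period_pos by simp
      have "z ! i = X ! (i mod p)" using nth_eq_root[of i] i X[of "i mod p"] m len by simp
      also have "\<dots> = X ! (i mod p + d)" by (rule has_period_nth[OF per]) (use m d len in linarith)
      also have "\<dots> = root ! ((i mod p + d) mod p)" by (rule X) (use m d len in linarith)
      also have "\<dots> = root ! ((i + d) mod p)" by (simp add: mod_add_left_eq)
      also have "\<dots> = z ! (i + d)" using nth_eq_root[OF i] by simp
      finally show "z ! i = z ! (i + d)" .
    qed
    then show False using least d by blast
  qed
qed

end

context equation
begin

text \<open>
  A long solution \<open>y\<close> satisfies \<open>s y = y \<tau>\<close> for some \<open>\<tau>\<close>, and \<open>\<tau> = t\<close> has to be shown.  With \<open>d = t + \<tau>\<close>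
  the relation \<open>s y Y' = y Y\<close> gives \<open>d Y' = Y + t Y'\<close>, which is the defect for \<open>y\<close> of the equation that \<open>x\<close>
  satisfies one coefficient later.  The structure found for \<open>x\<close> at that coefficient factors the defect
  as \<open>\<psi> y Z\<close>, where \<open>\<psi>\<close> is that coefficient or a left factor of it, and \<open>no_constant_shift\<close> applies.
\<close>

lemma long_solution:
  assumes i: "1 \<le> i" "i < n" and PQ: "(P, Q) \<in> splittings"
    and s: "tops s = {root}" "s * x = x * t" and t: "tops t = {coroot}"
    and eq_x: "P s * tail u x n (Suc i) = Q s * tail v x n (Suc i)"
    and y: "y \<noteq> 0" "4 * D \<le> deg y"
    and eq_y: "P s * tail u y n (Suc i) = Q s * tail v y n (Suc i)"
  shows "s * y = y * t"
proof -
  define k where "k = Suc i"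
  have k: "2 \<le> k" "k \<le> n" "1 \<le> k" using i by (simp_all add: k_def)
  note x0 = tops_singleton_nonzero[OF tops_x]
  have lz: "2 * p \<le> length z" using p_le long by linarith
  define Yu where "Yu = (\<lambda>w. u k * tail u w n (Suc k))"
  define Yv where "Yv = (\<lambda>w. v k * tail v w n (Suc k))"
  have tails: "tail u w n k = w * Yu w" "tail v w n k = w * Yv w" for w
    unfolding Yu_def Yv_def by (rule tail_step[OF k(2)])+
  have Y0: "Yu w \<noteq> 0" "Yv w \<noteq> 0" if "w \<noteq> 0" for w
    unfolding Yu_def Yv_def using left.rest_nonzero[OF that k(3,2)] right.rest_nonzero[OF that k(3,2)] .
  obtain Y Y' where Y: "(\<forall>a b. Y a b = a) \<or> (\<forall>a b. Y a b = b)"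
    and rel: "\<And>s x a b. P s * (x * a) = Q s * (x * b) \<Longrightarrow> s * (x * Y' a b) = x * Y a b"
    and sum: "\<And>t a b. P t * a + Q t * b = Y a b + t * Y' a b"
    using splitting_relation[OF PQ] by blast
  have rel_x: "s * (x * Y' (Yu x) (Yv x)) = x * Y (Yu x) (Yv x)"
    and rel_y: "s * (y * Y' (Yu y) (Yv y)) = y * Y (Yu y) (Yv y)"
    using eq_x eq_y unfolding k_def[symmetric] tails by (auto intro: rel)
  have Yy0: "Y (Yu y) (Yv y) \<noteq> 0" using Y Y0[OF y(1)] by auto
  have preU: "prefix coroot (U k)" if "\<forall>a b. Y a b = a"
  proof -
    obtain w where w: "w \<in> tops (Yu x)" using tops_nonempty[OF Y0(1)[OF x0]] by blast
    have "prefix coroot w" using rest_starts_with_coroot[OF tops_x s(1) rel_x, of w] w that by simp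
    then show ?thesis using left.coroot_prefix[OF tops_x k(1,2)] w unfolding Yu_def by blast
  qed
  have preV: "prefix coroot (V k)" if "\<forall>a b. Y a b = b"
  proof -
    obtain w where w: "w \<in> tops (Yv x)" using tops_nonempty[OF Y0(2)[OF x0]] by blast
    have "prefix coroot w" using rest_starts_with_coroot[OF tops_x s(1) rel_x, of w] w that by simp
    then show ?thesis using right.coroot_prefix[OF tops_x k(1,2)] w unfolding Yv_def by blast
  qed
  have "prefix coroot w" if w: "w \<in> tops (Y (Yu y) (Yv y))" for w
  proof -
    have tl: "tail u y n (Suc k) \<noteq> 0" "tail v y n (Suc k) \<noteq> 0"
      using Y0[OF y(1)] unfolding Yu_def Yv_def by auto
    show ?thesis
    proof (cases "\<forall>a b. Y a b = a")
      case True
      then have "w \<in> tops (u k * tail u y n (Suc k))" using w by (simp add: Yu_def)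
      then obtain b where "w = U k @ b"
        using tl left.u_nonzero[OF k(3,2)] by (auto simp: tops_mult left.tops_u[OF k(3,2)])
      then show ?thesis using preU[OF True] by (simp add: prefix_def) (metis append.assoc)
    next
      case False
      then have R: "\<forall>a b. Y a b = b" using Y by blast
      then have "w \<in> tops (v k * tail v y n (Suc k))" using w by (simp add: Yv_def)
      then obtain b where "w = V k @ b"
        using tl right.u_nonzero[OF k(3,2)] by (auto simp: tops_mult right.tops_u[OF k(3,2)])
      then show ?thesis using preV[OF R] by (simp add: prefix_def) (metis append.assoc)
    qed
  qed
  then obtain X where X: "tops y = {X}" "\<forall>j < length X. X ! j = root ! (j mod p)" "root @ X = X @ coroot"
    using long_solution_top[OF s(1) rel_y Yy0 _ y(1)] y(2) p_le by force
  have lX: "4 * D \<le> length X" using y(2) tops_singleton_deg[OF X(1)] by simp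
  have lX2: "2 * p \<le> length X" "p \<le> length X" using lX p_le by linarith+
  have perX: "has_period p X" "take (2 * p) X = take (2 * p) z" "\<And>d. d < p \<Longrightarrow> \<not> has_period d X"
    using root_power_periods[of X] X(2) lX2 lz by blast+
  obtain \<tau> where \<tau>: "s * y = y * \<tau>" "tops \<tau> = {coroot}" "P \<tau> * Yu y = Q \<tau> * Yv y"
    using advance[OF X(1) perX(1) lX2(2) X(3) perX(2) i PQ s(1) eq_y] unfolding Yu_def Yv_def k_def by blast
  obtain \<tau>0 where \<tau>0: "s * x = x * \<tau>0" "P \<tau>0 * Yu x = Q \<tau>0 * Yv x"
    using advance_x[OF i PQ s(1) eq_x] unfolding Yu_def Yv_def k_def by blast
  have "\<tau>0 = t" using \<tau>0(1) s(2) x0 by simp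
  then have tx: "P t * Yu x = Q t * Yv x" using \<tau>0(2) by simp
  have "t + \<tau> = 0"
  proof (rule ccontr)
    assume d: "t + \<tau> \<noteq> 0"
    have "lower (t + \<tau>) t" using lower_add_of_tops_eq[of t \<tau>] t \<tau>(2) tops_singleton_nonzero[OF t] by simp
    then have dd: "deg (t + \<tau>) < p" using d tops_singleton_deg[OF t] length_coroot by (simp add: lower_def)
    define W where "W = Y' (Yu y) (Yv y)"
    have "Y (Yu y) (Yv y) + \<tau> * W = 0" unfolding W_def sum[symmetric] \<tau>(3) by simp
    then have YW: "Y (Yu y) (Yv y) = \<tau> * W" by (simp only: free_alg_add_eq_0_iff)
    then have W: "W \<noteq> 0" using Yy0 by auto
    have "P t * Yu y + Q t * Yv y = \<tau> * W + t * W" unfolding sum YW W_def ..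
    then have dW: "(t + \<tau>) * W = P t * Yu y + Q t * Yv y" by (simp add: distrib_right add.commute)
    have dW0: "(t + \<tau>) * W \<noteq> 0" using d W by simp
    \<comment> \<open>At the last coefficient the remainders are single coefficients, in which \<open>x\<close> and \<open>y\<close> do not occur, so the defect vanishes.\<close>
    have kn: "k < n"
    proof (rule ccontr)
      assume "\<not> k < n"
      then have kn: "k = n" using k by simp
      have "P t * Yu y = Q t * Yv y" using tx unfolding Yu_def Yv_def kn by simp
      then show False using dW dW0 by simp
    qed
    have k': "Suc k \<le> n" using kn by simp
    define Zu where "Zu = u (Suc k) * tail u y n (Suc (Suc k))"
    define Zv where "Zv = v (Suc k) * tail v y n (Suc (Suc k))"
    have Yuy: "Yu y = u k * (y * Zu)" and Yvy: "Yv y = v k * (y * Zv)"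
      unfolding Yu_def Yv_def Zu_def Zv_def tail_step[OF k'] by simp_all
    obtain \<alpha> where \<alpha>: "tops (P t * u k) = {\<alpha>}" "\<alpha> = U k \<or> \<alpha> = coroot @ U k"
      using next_coefficient_tops(1)[OF insertI2[OF PQ] t k(3,2)] by blast
    obtain \<beta> where \<beta>: "tops (Q t * v k) = {\<beta>}" "\<beta> = V k \<or> \<beta> = coroot @ V k"
      using next_coefficient_tops(2)[OF insertI2[OF PQ] t k(3,2)] by blast
    have eq_k: "P t * u k * tail u x n (Suc k) = Q t * v k * tail v x n (Suc k)"
      using tx unfolding Yu_def Yv_def by (simp only: mult.assoc)
    obtain \<psi> \<psi>0 Z where \<psi>: "tops \<psi> = {\<psi>0}" "(t + \<tau>) * W = \<psi> * (y * Z)"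
      "\<alpha> = \<psi>0 \<or> \<alpha> = \<psi>0 @ root" "\<beta> = \<psi>0 \<or> \<beta> = \<psi>0 @ root"
    proof (cases "P t * u k = Q t * v k")
      case True
      have "(t + \<tau>) * W = (P t * u k) * (y * Zu) + (Q t * v k) * (y * Zv)"
        unfolding dW Yuy Yvy by (simp only: mult.assoc)
      also have "\<dots> = (P t * u k) * (y * (Zu + Zv))"
        unfolding True by (simp add: distrib_left)
      finally have "(t + \<tau>) * W = (P t * u k) * (y * (Zu + Zv))" .
      moreover have "\<beta> = \<alpha>" using \<alpha>(1) \<beta>(1) True by simp
      ultimately show ?thesis using that[OF \<alpha>(1)] by blast
    next
      case False
      obtain r \<sigma> P' Q' where PQ': "(P', Q') \<in> splittings" and
        eqs: "P t * u k = r * P' \<sigma>" "Q t * v k = r * Q' \<sigma>" and \<sigma>: "tops \<sigma> = {root}" and r: "r \<noteq> 0"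
        using next_splitting[OF insertI2[OF PQ] t k(1) kn eq_k False] by blast
      have "r * (P' \<sigma> * tail u x n (Suc k)) = r * (Q' \<sigma> * tail v x n (Suc k))"
        using eq_k unfolding eqs by (simp only: mult.assoc)
      then have "P' \<sigma> * tail u x n (Suc k) = Q' \<sigma> * tail v x n (Suc k)" using r by simp
      then obtain \<tau>' where "\<sigma> * x = x * \<tau>'" using advance_x[OF k(3) kn PQ' \<sigma>] by blast
      then have "\<sigma> = s \<or> \<sigma> = s + 1"
        using conjugators_differ_by_constant[OF tops_x s \<sigma>] by blast
      then obtain \<tau>'' where "\<sigma> * y = y * \<tau>''"
      proof
        assume "\<sigma> = s"
        then show ?thesis using that \<tau>(1) by blast
      next
        assume "\<sigma> = s + 1"
        then have "\<sigma> * y = y * (\<tau> + 1)" using \<tau>(1) by (simp add: distrib_left distrib_right)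
        then show ?thesis by (rule that)
      qed
      note comm = splitting_commutes[OF PQ' this]
      have "(t + \<tau>) * W = (P t * u k) * (y * Zu) + (Q t * v k) * (y * Zv)"
        unfolding dW Yuy Yvy by (simp only: mult.assoc)
      also have "\<dots> = r * ((P' \<sigma> * y) * Zu + (Q' \<sigma> * y) * Zv)"
        unfolding eqs by (simp only: mult.assoc distrib_left)
      also have "\<dots> = r * (y * (P' \<tau>'' * Zu + Q' \<tau>'' * Zv))"
        using comm by (simp add: mult.assoc distrib_left)
      finally have eq_r: "(t + \<tau>) * W = r * (y * (P' \<tau>'' * Zu + Q' \<tau>'' * Zv))" .
      have root0: "root \<noteq> []" using length_root period_pos by (metis list.size(3) less_irrefl)
      have tPQ: "(tops (P' \<sigma>) = {[]} \<or> tops (P' \<sigma>) = {root}) \<and> (tops (Q' \<sigma>) = {[]} \<or> tops (Q' \<sigma>) = {root})"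
        using tops_splitting[OF PQ' \<sigma> root0] .
      have left_r: "\<exists>a0. tops r = {a0} \<and> (\<gamma> = a0 \<or> \<gamma> = a0 @ root)"
        if "tops (r * c) = {\<gamma>}" "tops c = {[]} \<or> tops c = {root}" for c \<gamma>
        using that tops_left_factor[of r c \<gamma>] by fastforce
      obtain a0 where a0: "tops r = {a0}" "\<alpha> = a0 \<or> \<alpha> = a0 @ root"
        using left_r[of "P' \<sigma>" \<alpha>] \<alpha>(1) tPQ unfolding eqs by blast
      obtain b0 where "tops r = {b0}" "\<beta> = b0 \<or> \<beta> = b0 @ root"
        using left_r[of "Q' \<sigma>" \<beta>] \<beta>(1) tPQ unfolding eqs by blast
      then have "\<beta> = a0 \<or> \<beta> = a0 @ root" using a0(1) by simp
      then show ?thesis using that[OF a0(1) eq_r a0(2)] by blast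
    qed
    have lU: "length (U k) + 3 * p \<le> length X" "length (V k) + 3 * p \<le> length X"
      using U_le[OF k(3,2)] V_le[OF k(3,2)] p_le lX by linarith+
    show False
    proof (cases "\<forall>a b. Y a b = a")
      case True
      have "u k * tail u y n (Suc k) = \<tau> * W" using YW True unfolding Yu_def by simp
      then show False
        using left.no_constant_shift[OF k(1) kn X(1) perX(2,1,3) lU(1) preU[OF True] \<psi>(1) \<alpha>(2) \<psi>(3) _ \<tau>(2) \<psi>(2) d dd]
        by blast
    next
      case False
      then have R: "\<forall>a b. Y a b = b" using Y by blast
      have "v k * tail v y n (Suc k) = \<tau> * W" using YW R unfolding Yv_def by simp
      then show False
        using right.no_constant_shift[OF k(1) kn X(1) perX(2,1,3) lU(2) preV[OF R] \<psi>(1) \<beta>(2) \<psi>(4) _ \<tau>(2) \<psi>(2) d dd]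
        by blast
    qed
  qed
  then have "t = \<tau>" by (simp only: free_alg_add_eq_0_iff)
  then show ?thesis using \<tau>(1) by simp
qed

end

section \<open>The theorem\<close>

lemma deg_side:
  fixes x :: "'a free_alg"
  assumes x: "x \<noteq> 0" and u: "\<And>i. i \<in> {1..n} \<Longrightarrow> u i \<noteq> 0" and n: "1 \<le> n"
  shows "deg (side u x n) = (\<Sum>i=1..n. deg (u i)) + (n - 1) * deg x"
proof -
  have tl: "tail u x n k \<noteq> 0 \<and> deg (tail u x n k) = (\<Sum>i=k..n. deg (u i)) + (Suc n - k) * deg x"
    if "k \<le> Suc n" "1 \<le> k" for k
    using that
  proof (induction k rule: inc_induct)
    case base
    have "deg (1 :: 'a free_alg) = 0" using tops_singleton_deg[OF tops_one] by simp
    then show ?case by simp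
  next
    case (step k)
    then have IH: "tail u x n (Suc k) \<noteq> 0"
      "deg (tail u x n (Suc k)) = (\<Sum>i=Suc k..n. deg (u i)) + (n - k) * deg x" by simp_all
    have k: "k \<le> n" using step by simp
    have uk: "u k \<noteq> 0" using u step by simp
    have "deg (tail u x n k) = deg x + (deg (u k) + deg (tail u x n (Suc k)))"
      unfolding tail_step[OF k] using x uk IH(1) by (simp add: deg_mult)
    moreover have "(\<Sum>i=k..n. deg (u i)) = deg (u k) + (\<Sum>i=Suc k..n. deg (u i))"
      using sum.atLeast_Suc_atMost[OF k] .
    moreover have "tail u x n k \<noteq> 0" unfolding tail_step[OF k] using x uk IH(1) by simp
    moreover have "(Suc n - k) * deg x = deg x + (n - k) * deg x" using k by (simp add: Suc_diff_le)
    ultimately show ?case using IH(2) by simp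
  qed
  have "deg (side u x n) = deg (u 1) + deg (tail u x n 2)"
    unfolding side_eq_tail using tl[of 2] u[of 1] n by (simp add: deg_mult numeral_2_eq_2)
  also have "\<dots> = (\<Sum>i=1..n. deg (u i)) + (n - 1) * deg x"
    using tl[of 2] n sum.atLeast_Suc_atMost[OF n, of "\<lambda>i. deg (u i)"] by (simp add: numeral_2_eq_2)
  finally show ?thesis .
qed

text \<open>
  At the first index where the coefficients differ, nothing has been carried over from the
  left, and the absence of squares in the coefficient itself suffices.
\<close>

lemma (in least_period) squarefree_no_repeat:
  assumes "no_periodicity w" "e \<noteq> []" "length e \<le> p" "prefix e z"
  shows "\<not> suffix (e @ root) w"
proof
  assume s: "suffix (e @ root) w"
  have "prefix e root" using prefix_length_prefix[OF assms(4) take_is_prefix] assms(3) length_root by simp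
  then obtain g where g: "root = e @ g" by (auto simp: prefix_def)
  obtain h where "w = h @ e @ root" using s by (auto simp: suffix_def)
  then have "w = h @ e @ e @ g" using g by simp
  then show False using no_periodicityD[OF assms(1)] assms(2) by blast
qed

theorem theorem4p7:
  fixes u v :: "nat \<Rightarrow> 'a::finite free_alg" and x1 :: "'a free_alg" and n :: nat
  assumes "n \<ge> 2"
    and "\<And>i. i \<in> {1..n} \<Longrightarrow> is_monomial (top_part (u i)) \<and> no_periodicity (top_word (u i))"
    and "\<And>i. i \<in> {1..n} \<Longrightarrow> is_monomial (top_part (v i)) \<and> no_periodicity (top_word (v i))"
    and "\<exists>i\<in>{1..n}. u i \<noteq> v i"
    and "side u x1 n = side v x1 n"
    and "deg x1 > 2 * (\<Sum>i=1..n. deg (u i))\<^sup>2"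
    and "is_monomial (top_part x1)"
    and "periodicity_contained (\<lambda>i. top_word (u i)) (top_word x1) n"
    and "periodicity_contained (\<lambda>i. top_word (v i)) (top_word x1) n"
  shows "\<exists>s t :: 'a free_alg. s \<noteq> 0 \<and> t \<noteq> 0 \<and>
    deg s = deg t \<and> deg t \<le> (MAX i\<in>{1..n}. deg (u i)) \<and>
    (\<forall>x. s * x = x * t \<longrightarrow> side u x n = side v x n) \<and>
    (\<forall>x2. side u x2 n = side v x2 n \<and>
       deg x2 > 2 * (2 + 2 ^ (deg s + 2)) + (2 * (\<Sum>i=1..n. deg (u i)))\<^sup>2 \<longrightarrow>
       s * x2 = x2 * t)"
proof -
  define z where "z = top_word x1"
  define p where "p = min_period z"
  define U where "U = (\<lambda>i. top_word (u i))"
  define V where "V = (\<lambda>i. top_word (v i))"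
  define D where "D = (\<Sum>i=1..n. deg (u i))"
  have tx: "tops x1 = {z}" unfolding z_def by (rule tops_top_monomial[OF assms(7)])
  have tu: "tops (u i) = {U i}" if "i \<in> {1..n}" for i
    unfolding U_def using assms(2)[OF that] by (intro tops_top_monomial) blast
  have tv: "tops (v i) = {V i}" if "i \<in> {1..n}" for i
    unfolding V_def using assms(3)[OF that] by (intro tops_top_monomial) blast
  have u0: "u i \<noteq> 0" if "i \<in> {1..n}" for i by (rule tops_singleton_nonzero[OF tu[OF that]])
  have v0: "v i \<noteq> 0" if "i \<in> {1..n}" for i by (rule tops_singleton_nonzero[OF tv[OF that]])
  note x0 = tops_singleton_nonzero[OF tx]
  have n1: "1 \<le> n" using assms(1) by simp
  have D_v: "D = (\<Sum>i=1..n. deg (v i))"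
    using arg_cong[OF assms(5), of deg] deg_side[OF x0 u0 n1] deg_side[OF x0 v0 n1] by (simp add: D_def)
  have UD: "length (U i) \<le> D" if "i \<in> {1..n}" for i
    unfolding D_def tops_singleton_deg[OF tu[OF that], symmetric]
    by (rule member_le_sum[OF that]) simp_all
  have VD: "length (V i) \<le> D" if "i \<in> {1..n}" for i
    unfolding D_v tops_singleton_deg[OF tv[OF that], symmetric]
    by (rule member_le_sum[OF that]) simp_all
  have lz: "2 * D\<^sup>2 < length z" using assms(6) tops_singleton_deg[OF tx] by (simp add: D_def)
  have z: "z \<noteq> []" using lz by auto
  interpret least_period z p
    unfolding p_def
  proof
    show "has_period (min_period z) z" "min_period z \<le> length z" using min_period[OF z] .
    show "\<not> has_period d z" if "d < min_period z" for d
      using not_less_Least[of d "\<lambda>p. has_period p z"] that unfolding min_period_def by blast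
  qed
  \<comment> \<open>The coefficients before the first difference cancel; the last coefficient cannot be the first to differ.\<close>
  define i where "i = (LEAST i. i \<in> {1..n} \<and> u i \<noteq> v i)"
  have i: "i \<in> {1..n} \<and> u i \<noteq> v i" unfolding i_def by (rule LeastI_ex) (use assms(4) in blast)
  have same: "u j = v j" if "1 \<le> j" "j < i" for j
  proof -
    have "\<not> (j \<in> {1..n} \<and> u j \<noteq> v j)" using not_less_Least that(2) unfolding i_def by blast
    moreover have "j \<in> {1..n}" using that i by simp
    ultimately show ?thesis by blast
  qed
  have i1: "1 \<le> i" "i \<le> n" using i by simp_all
  have uj0: "u j \<noteq> 0" if "1 \<le> j" "j < i" for j using u0[of j] that i1 by simp
  have eq_i: "u i * tail u y n (Suc i) = v i * tail v y n (Suc i)"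
    if "y \<noteq> 0" "side u y n = side v y n" for y
    using side_eqD[OF i1 same that(1) uj0 that(2)] .
  have "i < n"
  proof (rule ccontr)
    assume "\<not> i < n"
    then have "i = n" using i1 by simp
    then show False using eq_i[OF x0 assms(5)] i by simp
  qed
  then have i': "Suc i \<le> n" "1 \<le> Suc i" "2 \<le> Suc i" "i < n" using i1 by simp_all
  have "tail u x1 n (Suc (Suc i)) \<noteq> 0" by (rule tail_nonzero[OF x0]) (use u0 i' in auto)
  then have rest_u: "u (Suc i) * tail u x1 n (Suc (Suc i)) \<noteq> 0" using u0[of "Suc i"] i' by simp
  have "tail v x1 n (Suc (Suc i)) \<noteq> 0" by (rule tail_nonzero[OF x0]) (use v0 i' in auto)
  then have rest_v: "v (Suc i) * tail v x1 n (Suc (Suc i)) \<noteq> 0" using v0[of "Suc i"] i' by simp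
  have D2: "2 * D \<le> 2 * D\<^sup>2" by (simp add: power2_eq_square)
  have lens: "length (U i) + min p (length (U i)) \<le> length z" "length (V i) + min p (length (V i)) \<le> length z"
    using UD[of i] VD[of i] i lz D2 by (auto simp: min_def)
  have eq_x: "u i * (x1 * (u (Suc i) * tail u x1 n (Suc (Suc i)))) =
      v i * (x1 * (v (Suc i) * tail v x1 n (Suc (Suc i))))"
    using eq_i[OF x0 assms(5)] unfolding tail_step[OF i'(1)] .
  have sf: "no_periodicity (U i)" "no_periodicity (V i)"
    using assms(2)[of i] assms(3)[of i] i unfolding U_def V_def by simp_all
  have "\<exists>r s P Q. (P, Q) \<in> splittings \<and> u i = r * P s \<and> v i = r * Q s \<and> tops s = {root} \<and> r \<noteq> 0"
  proof (rule splitting_exists[OF tx _ _ _ rest_u rest_v eq_x lens])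
    show "tops (u i) = {U i}" "tops (v i) = {V i}" "u i \<noteq> v i" using tu tv i by simp_all
    show "\<not> suffix (e @ root) (U i)" "\<not> suffix (e @ root) (V i)"
      if "e \<noteq> []" "length e \<le> p" "prefix e z" for e
      using squarefree_no_repeat[OF sf(1) that] squarefree_no_repeat[OF sf(2) that] .
  qed
  then obtain r s P Q where PQ: "(P, Q) \<in> splittings" and
    eqs: "u i = r * P s" "v i = r * Q s" and s: "tops s = {root}" and r: "r \<noteq> 0" by blast
  have root_last: "p \<le> length w" if w: "tops (r * s) = {w}" for w
  proof -
    obtain a where "w = a @ root" using tops_left_factor[OF w s] by blast
    then show ?thesis using length_root by simp
  qed
  have root_last': "p \<le> length w" if w: "tops (r * (s + 1)) = {w}" for w
  proof -
    have "root \<noteq> []" using length_root period_pos by (metis list.size(3) less_irrefl)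
    then have "tops (s + 1) = {root}" using tops_add_one[OF s] by blast
    then obtain a where "w = a @ root" using tops_left_factor[OF w] by blast
    then show ?thesis using length_root by simp
  qed
  \<comment> \<open>One of the two coefficients has a right factor with top word \<open>\<rho>\<close>, which bounds \<open>p\<close> by a degree.\<close>
  have pUV: "p \<le> length (U i) \<or> (P = (\<lambda>s. 1) \<and> Q = (\<lambda>s. s) \<and> p \<le> length (V i))"
    using PQ
  proof (cases rule: splitting_cases)
    case 1
    then show ?thesis using root_last[of "V i"] tv[of i] i eqs by simp
  next
    case 2
    then show ?thesis using root_last[of "U i"] tu[of i] i eqs by simp
  next
    case 3
    then show ?thesis using root_last'[of "U i"] tu[of i] i eqs by simp
  qed
  then have pD: "p \<le> D" using UD[OF conjunct1[OF i]] VD[OF conjunct1[OF i]] by linarith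
  then have D1: "1 \<le> D" using period_pos by simp
  then obtain m where m: "D = Suc m" by (cases D) auto
  \<comment> \<open>\<open>3 D \<le> 2 D\<^sup>2 + 1\<close> holds for all integers \<open>D \<ge> 1\<close>, with equality at \<open>D = 1\<close>.\<close>
  have D3: "3 * D \<le> length z" using lz unfolding m power2_eq_square by simp
  have D4: "4 * D \<le> (2 * D)\<^sup>2" unfolding m power2_eq_square by simp
  have z2: "2 * p \<le> length z" using pD D3 by linarith
  interpret equation z p u U v V n x1 D
  proof (unfold_locales)
    show "tops (u i) = {U i}" "tops (v i) = {V i}" "length (U i) \<le> D" "length (V i) \<le> D"
      if "1 \<le> i" "i \<le> n" for i
      using tu tv UD VD that by simp_all
    show "no_periodicity (U i)" "no_periodicity (V i)" if "1 \<le> i" "i \<le> n" for i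
      using assms(2,3) that by (simp_all add: U_def V_def)
    show "junction p z (U k)" "junction p z (V k)" if "2 \<le> k" "k < n" for k
      using periodicity_contained_junction[OF assms(8) _ that] periodicity_contained_junction[OF assms(9) _ that] z
      by (simp_all add: U_def V_def p_def z_def)
  qed (use tx pD D3 z2 in simp_all)
  have eq_s: "P s * tail u y n (Suc i) = Q s * tail v y n (Suc i)"
    if "y \<noteq> 0" "side u y n = side v y n" for y
    using eq_i[OF that] r unfolding eqs by (simp add: mult.assoc)
  obtain t where st: "s * x1 = x1 * t" and t: "tops t = {coroot}" and
    adv: "P t * (u (Suc i) * tail u x1 n (Suc (Suc i))) = Q t * (v (Suc i) * tail v x1 n (Suc (Suc i)))"
    using advance_x[OF i1(1) i'(4) PQ s eq_s[OF x0 assms(5)]] by blast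
  have degs: "deg s = p" "deg t = p"
    using tops_singleton_deg[OF s] tops_singleton_deg[OF t] length_root length_coroot by simp_all
  have bound: "deg t \<le> (MAX i\<in>{1..n}. deg (u i))"
  proof -
    \<comment> \<open>If only \<open>v\<^sub>i\<close> is that long, then the next coefficient \<open>u\<^bsub>i+1\<^esub>\<close> begins with \<open>w\<close>.\<close>
    have "\<exists>k\<in>{1..n}. p \<le> length (U k)"
    proof (cases "p \<le> length (U i)")
      case True
      then show ?thesis using i by blast
    next
      case False
      then have P: "P = (\<lambda>s. 1)" "Q = (\<lambda>s. s)" using pUV by blast+
      have "s * (x1 * (v (Suc i) * tail v x1 n (Suc (Suc i)))) = x1 * (u (Suc i) * tail u x1 n (Suc (Suc i)))"
        using eq_s[OF x0 assms(5)] unfolding P tail_step[OF i'(1)] by simp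
      moreover obtain w where w: "w \<in> tops (u (Suc i) * tail u x1 n (Suc (Suc i)))"
        using tops_nonempty[OF rest_u] by blast
      ultimately have "prefix coroot w" using rest_starts_with_coroot[OF tx s] by blast
      then have "prefix coroot (U (Suc i))" using left.coroot_prefix[OF tx i'(3,1) w] by blast
      then have "p \<le> length (U (Suc i))" using prefix_length_le length_coroot by metis
      then show ?thesis using i' by (intro bexI[of _ "Suc i"]) simp_all
    qed
    then obtain k where k: "k \<in> {1..n}" "p \<le> deg (u k)" using tops_singleton_deg[OF tu] by metis
    have "deg (u k) \<le> (MAX i\<in>{1..n}. deg (u i))" using k(1) by (intro Max_ge) auto
    then show ?thesis unfolding degs(2) by (rule order.trans[OF k(2)])
  qed
  have conj1: "side u x n = side v x n" if x: "s * x = x * t" for x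
  proof -
    have eq': "P t * u (Suc i) * tail u x n (Suc (Suc i)) = Q t * v (Suc i) * tail v x n (Suc (Suc i))"
      by (rule intertwined_solution[OF s st t x i'(3,1) insertI2[OF PQ]]) (use adv in \<open>simp_all add: mult.assoc\<close>)
    have comm: "P s * x = x * P t" "Q s * x = x * Q t" using splitting_commutes[OF PQ x] by simp_all
    have "u i * tail u x n (Suc i) = r * ((P s * x) * (u (Suc i) * tail u x n (Suc (Suc i))))"
      unfolding eqs(1) tail_step[OF i'(1)] by (simp only: mult.assoc)
    also have "\<dots> = r * (x * (P t * u (Suc i) * tail u x n (Suc (Suc i))))"
      unfolding comm by (simp only: mult.assoc)
    also have "\<dots> = r * ((Q s * x) * (v (Suc i) * tail v x n (Suc (Suc i))))"
      unfolding comm eq' by (simp only: mult.assoc)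
    also have "\<dots> = v i * tail v x n (Suc i)"
      unfolding eqs(2) tail_step[OF i'(1)] by (simp only: mult.assoc)
    finally have "u i * tail u x n (Suc i) = v i * tail v x n (Suc i)" .
    then show ?thesis by (rule side_eqI[OF i1 same, rotated -1])
  qed
  have conj2: "s * x2 = x2 * t"
    if side: "side u x2 n = side v x2 n" and d: "2 * (2 + 2 ^ (deg s + 2)) + (2 * D)\<^sup>2 < deg x2" for x2
  proof (rule long_solution[OF i1(1) i'(4) PQ s st t eq_s[OF x0 assms(5)]])
    show x2: "x2 \<noteq> 0" using d by (auto simp: deg_def)
    show "4 * D \<le> deg x2" using d D4 by linarith
    show "P s * tail u x2 n (Suc i) = Q s * tail v x2 n (Suc i)" by (rule eq_s[OF x2 side])
  qed
  show ?thesis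
    using bound conj1 conj2 degs tops_singleton_nonzero[OF s] tops_singleton_nonzero[OF t]
    unfolding D_def by (intro exI[of _ s] exI[of _ t]) simp
qed

end
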